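(* Let $k$ be a field, let $A$ be a free abelian group of finite rank, and let $G$ be a finite group acting faithfully by automorphisms on $A$, where $\operatorname{char} k$ does not divide $|G|$. Let $R=k[A]^G$ be the algebra of $G$-invariants in the group algebra $k[A]$. If $G$ has odd prime order, then $R$ is not a semigroup algebra over $k$.
   Context: The action of $G$ on $A$ is extended $k$-linearly to the group algebra $k[A]$. A semigroup algebra over $k$ is a $k$-algebra isomorphic to the monoid algebra $k[M]$ of some commutative monoid $M$. *)

theory Defs
  imports
    "HOL-Library.Poly_Mapping"
    "HOL-Computational_Algebra.Primes"
    "HOL-Algebra.Bij"
    "HOL-Algebra.Free_Abelian_Groups"
begin

text \<open>
  For a field \<open>'k\<close> and a commutative monoid \<open>'m\<close>, written additively, the type
  \<open>'m \<Rightarrow>\<^sub>0 'k\<close> with its convolution product is the monoid algebra \<open>k[M]\<close>; the basis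
  element of \<open>k[M]\<close> given by \<open>m\<close> is \<open>Poly_Mapping.single m 1\<close>. When \<open>'m\<close> is an abelian group
  this is the group algebra.
\<close>

definition additive_group :: "'a::ab_group_add itself \<Rightarrow> 'a monoid"
  where "additive_group _ = \<lparr>carrier = UNIV, monoid.mult = (+), one = (0::'a)\<rparr>"

definition free_abelian_finite_rank :: "('a, 'b) monoid_scheme \<Rightarrow> bool"
  where "free_abelian_finite_rank A \<longleftrightarrow> (\<exists>n::nat. A \<cong> free_Abelian_group {..<n})"

definition algebra_scale :: "'k::field \<Rightarrow> ('m \<Rightarrow>\<^sub>0 'k) \<Rightarrow> ('m \<Rightarrow>\<^sub>0 'k)"
  where "algebra_scale c p = Poly_Mapping.map ((*) c) p"

definition linear_extension :: "('a \<Rightarrow> 'b) \<Rightarrow> ('a \<Rightarrow>\<^sub>0 'k::field) \<Rightarrow> ('b \<Rightarrow>\<^sub>0 'k)"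
  where "linear_extension f p =
    (\<Sum>a\<in>Poly_Mapping.keys p. Poly_Mapping.single (f a) (Poly_Mapping.lookup p a))"

definition invariant_algebra ::
    "('g, 'b) monoid_scheme \<Rightarrow> ('g \<Rightarrow> 'a \<Rightarrow> 'a) \<Rightarrow> ('a \<Rightarrow>\<^sub>0 'k::field) set"
  where "invariant_algebra G \<phi> = {p. \<forall>g\<in>carrier G. linear_extension (\<phi> g) p = p}"

definition algebra_iso_onto ::
    "(('m::comm_monoid_add \<Rightarrow>\<^sub>0 'k::field) \<Rightarrow> ('a::comm_monoid_add \<Rightarrow>\<^sub>0 'k)) \<Rightarrow> ('a \<Rightarrow>\<^sub>0 'k) set \<Rightarrow> bool"
  where "algebra_iso_onto F R \<longleftrightarrow>
    bij_betw F UNIV R \<and>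
    F 1 = 1 \<and>
    (\<forall>p q. F (p + q) = F p + F q) \<and>
    (\<forall>p q. F (p * q) = F p * F q) \<and>
    (\<forall>c p. F (algebra_scale c p) = algebra_scale c (F p))"

text \<open>
  A subalgebra \<open>R\<close> of \<open>k[A]\<close> is a semigroup algebra if it is isomorphic to \<open>k[M]\<close> for some
  commutative monoid \<open>M\<close>. HOL cannot quantify over types inside a formula, so the type of \<open>M\<close>
  is a parameter here. A theorem that refutes the predicate for a free type variable
  \<open>'m :: comm_monoid_add\<close> refutes it for all commutative monoids.
\<close>

definition semigroup_algebra_on ::
    "'m::comm_monoid_add itself \<Rightarrow> ('a::comm_monoid_add \<Rightarrow>\<^sub>0 'k::field) set \<Rightarrow> bool"
  where "semigroup_algebra_on _ R \<longleftrightarrow>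
    (\<exists>F :: ('m \<Rightarrow>\<^sub>0 'k) \<Rightarrow> ('a \<Rightarrow>\<^sub>0 'k). algebra_iso_onto F R)"

end

theory Submission
  imports "HOL-Computational_Algebra.Polynomial_Factorial" Defs
begin

text \<open>
  Let \<open>g\<close> generate \<open>G\<close>, let \<open>T = A\<^sup>G + (g - 1) A\<close>, a proper subgroup of \<open>A\<close>, and let \<open>I\<close> be the
  kernel of \<open>k[A] \<rightarrow> k[A / T]\<close>. A derivation \<open>D\<close> of \<open>R\<close> that kills \<open>k[A\<^sup>G]\<close> maps \<open>R\<close> into \<open>I\<close>: it
  extends to a derivation of \<open>k[A]\<close> into the field of fractions, whose denominators divide products of
  binomials \<open>1 - e\<^sup>u\<close> with \<open>u\<close> running over differences \<open>g\<^sup>i a - a\<close>; as \<open>p\<close> is odd, \<open>a\<close> can be varied so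
  that these products become coprime, so there are no denominators, and averaging over \<open>G\<close> shows that
  \<open>D\<close> vanishes on the fixed points of \<open>G\<close>.

  If \<open>R\<close> is isomorphic to \<open>k[M]\<close>, then the monomials \<open>e\<^sup>u\<close> with \<open>u \<in> A\<^sup>G\<close> come, up to scalars, from
  elements of \<open>M\<close>. Every other \<open>m \<in> M\<close> is an eigenvector with nonzero eigenvalue of a derivation as
  above, except that in characteristic \<open>q > 0\<close> one first has to split off a \<open>q\<close>-th power; so it lies in
  \<open>I\<close>. Hence the image of \<open>R\<close> in \<open>k[A / T]\<close> is \<open>k\<close>, whereas the orbit sum of \<open>a \<notin> T\<close> has the image
  \<open>p e\<^sup>a\<close>.
\<close>


subsection \<open>Monoid algebras\<close>

text \<open>Oddness cannot be dropped: for A = Z and g = -1 the invariants are k[t + 1/t], a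
  polynomial ring. There all differences g a - a lie on one line, so the binomials for different a
  always share a factor, and the derivative with respect to t + 1/t really acquires a denominator
  when it is extended to k[A]. For odd p the vectors y and g y are independent whenever y is moved,
  so replacing a by a + m g a tilts the differences out of any given direction. The subgroup T is
  dictated by the two kinds of elements of M: modulo T the vectors of A^G vanish, so e^u becomes 1,
  and an orbit collapses to a point. An abstract monoid offers no derivations by itself. They come
  from additive maps M -> k, and these are built from logarithmic derivatives of the elements of M
  inside the field of fractions. In characteristic q all of these can vanish on an element; but then
  its exponents lie in A^G + q A, and a q-th root can be extracted inside M, up to a unit.\<close>

lemma poly_mapping_single_induct [case_names single add]:
  fixes p :: "'a \<Rightarrow>\<^sub>0 'b::comm_monoid_add"
  assumes single: "\<And>a c. P (Poly_Mapping.single a c)"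
    and add: "\<And>p q. P p \<Longrightarrow> P q \<Longrightarrow> P (p + q)"
  shows "P p"
proof (induction p rule: update_induct)
  case const
  show ?case using single[of undefined 0] by simp
next
  case (update f a b)
  have "Poly_Mapping.update a b f = f + Poly_Mapping.single a b"
    by (rule poly_mapping_eqI)
      (use update in \<open>auto simp: lookup_update lookup_add lookup_single when_def in_keys_iff\<close>)
  then show ?case using add[OF update.IH single] by metis
qed

lemma poly_mapping_sum_single:
  fixes p :: "'a \<Rightarrow>\<^sub>0 'b::comm_monoid_add"
  shows "(\<Sum>a\<in>Poly_Mapping.keys p. Poly_Mapping.single a (Poly_Mapping.lookup p a)) = p"
  by (rule poly_mapping_eqI)
    (auto simp: lookup_sum lookup_single when_def in_keys_iff)

lemma single_one_eq_iff:
  "Poly_Mapping.single a 1 = (Poly_Mapping.single b 1 :: 'a \<Rightarrow>\<^sub>0 'b::zero_neq_one) \<longleftrightarrow> a = b"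
  by (metis lookup_single_eq lookup_single_not_eq zero_neq_one)

lemma algebra_scale_conv_mult: "algebra_scale c p = Poly_Mapping.single 0 c * p"
  for p :: "'a::comm_monoid_add \<Rightarrow>\<^sub>0 'k::field"
  unfolding algebra_scale_def by (rule mult_map_scale_conv_mult)

lemma lookup_const_mult:
  "Poly_Mapping.lookup (Poly_Mapping.single 0 c * p) a = c * Poly_Mapping.lookup p a"
  for p :: "'a::comm_monoid_add \<Rightarrow>\<^sub>0 'k::field"
  unfolding mult_map_scale_conv_mult[symmetric] by (simp add: map.rep_eq when_def)

lemma keys_const_mult:
  "c \<noteq> 0 \<Longrightarrow> Poly_Mapping.keys (Poly_Mapping.single 0 c * p) = Poly_Mapping.keys p"
  for p :: "'a::comm_monoid_add \<Rightarrow>\<^sub>0 'k::field"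
  by (auto simp: in_keys_iff lookup_const_mult)

lemma CHAR_poly_mapping [simp]:
  "CHAR('a::comm_monoid_add \<Rightarrow>\<^sub>0 'k::field) = CHAR('k)"
proof (rule CHAR_eqI)
  show "of_nat CHAR('k) = (0 :: 'a \<Rightarrow>\<^sub>0 'k)"
    by (metis of_nat_CHAR single_of_nat single_zero)
next
  fix n assume "of_nat n = (0 :: 'a \<Rightarrow>\<^sub>0 'k)"
  then have "of_nat n = (0::'k)"
    by (metis lookup_single_eq lookup_zero single_of_nat)
  then show "CHAR('k) dvd n" by (simp add: of_nat_eq_0_iff_char_dvd)
qed

section \<open>Functoriality of monoid algebras\<close>

lemma linear_extension_superset:
  assumes "finite X" "Poly_Mapping.keys p \<subseteq> X"
  shows "linear_extension f p = (\<Sum>a\<in>X. Poly_Mapping.single (f a) (Poly_Mapping.lookup p a))"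
  unfolding linear_extension_def
  by (rule sum.mono_neutral_left) (use assms in \<open>auto simp: in_keys_iff\<close>)

lemma linear_extension_add:
  "linear_extension f (p + q) = linear_extension f p + linear_extension f q"
proof -
  let ?X = "Poly_Mapping.keys p \<union> Poly_Mapping.keys q"
  have "Poly_Mapping.keys (p + q) \<subseteq> ?X" by (rule keys_add)
  then show ?thesis
    by (simp add: linear_extension_superset[of ?X] lookup_add single_add sum.distrib)
qed

lemma linear_extension_single [simp]:
  "linear_extension f (Poly_Mapping.single a c) = Poly_Mapping.single (f a) c"
  by (simp add: linear_extension_superset[of "{a}"])

lemma linear_extension_one: "f 0 = 0 \<Longrightarrow> linear_extension f 1 = 1"
  by (metis linear_extension_single single_one)

lemma linear_extension_0 [simp]: "linear_extension f 0 = 0"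
  by (simp add: linear_extension_def)

lemma linear_extension_sum:
  "linear_extension f (sum h X) = (\<Sum>x\<in>X. linear_extension f (h x))"
  by (induction X rule: infinite_finite_induct) (simp_all add: linear_extension_add)

lemma linear_extension_mult:
  fixes f :: "'a::comm_monoid_add \<Rightarrow> 'b::comm_monoid_add"
  assumes "\<And>x y. f (x + y) = f x + f y"
  shows "linear_extension f (p * q) = linear_extension f p * linear_extension f q"
proof (induction p rule: poly_mapping_single_induct)
  case (single a c)
  show ?case
    by (induction q rule: poly_mapping_single_induct)
      (simp_all add: mult_single assms linear_extension_add algebra_simps)
qed (simp add: linear_extension_add algebra_simps)

lemma linear_extension_comp:
  "linear_extension f (linear_extension h p) = linear_extension (f \<circ> h) p"
  by (induction p rule: poly_mapping_single_induct) (simp_all add: linear_extension_add)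

lemma linear_extension_id [simp]: "linear_extension id p = p"
  by (induction p rule: poly_mapping_single_induct) (simp_all add: linear_extension_add)

lemma lookup_linear_extension_inj:
  assumes "inj f"
  shows "Poly_Mapping.lookup (linear_extension f p) (f a) = Poly_Mapping.lookup p a"
  by (induction p rule: poly_mapping_single_induct)
    (use assms in \<open>auto simp: linear_extension_add lookup_add lookup_single when_def dest: injD\<close>)

lemma linear_extension_inj:
  assumes "inj f"
  shows "inj (linear_extension f)"
  by (rule injI, rule poly_mapping_eqI) (metis lookup_linear_extension_inj[OF assms])

text \<open>For additive \<open>\<delta>\<close> this is the degree derivation of the grading
  \<open>\<delta>\<close>. Arbitrary functions are allowed so that the same operator also serves as
  the projection onto a set of exponents, as in \<open>level_part\<close>.\<close>

definition euler :: "('a \<Rightarrow> 'k) \<Rightarrow> ('a \<Rightarrow>\<^sub>0 'k) \<Rightarrow> ('a \<Rightarrow>\<^sub>0 'k::field)"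
  where "euler \<delta> p = Poly_Mapping.mapp (\<lambda>a c. \<delta> a * c) p"

lemma lookup_euler [simp]:
  "Poly_Mapping.lookup (euler \<delta> p) a = \<delta> a * Poly_Mapping.lookup p a"
  by (simp add: euler_def lookup_mapp when_def in_keys_iff)

lemma euler_add: "euler \<delta> (p + q) = euler \<delta> p + euler \<delta> q"
  by (rule poly_mapping_eqI) (simp add: lookup_add algebra_simps)

lemma euler_single [simp]:
  "euler \<delta> (Poly_Mapping.single a c) = Poly_Mapping.single a (\<delta> a * c)"
  by (rule poly_mapping_eqI) (simp add: lookup_single when_def)

lemma euler_mult:
  fixes p q :: "'a::comm_monoid_add \<Rightarrow>\<^sub>0 'k::field"
  assumes "\<And>a b. \<delta> (a + b) = \<delta> a + \<delta> b"
  shows "euler \<delta> (p * q) = euler \<delta> p * q + p * euler \<delta> q"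
proof (induction p rule: poly_mapping_single_induct)
  case (single a c)
  show ?case
    by (induction q rule: poly_mapping_single_induct)
      (simp_all add: mult_single assms euler_add algebra_simps flip: single_add)
qed (simp add: euler_add algebra_simps)

section \<open>Frobenius powers\<close>

definition nat_times :: "nat \<Rightarrow> 'a::comm_monoid_add \<Rightarrow> 'a"
  where "nat_times n a = (\<Sum>i<n. a)"

lemma nat_times_0 [simp]: "nat_times 0 a = 0"
  and nat_times_Suc [simp]: "nat_times (Suc n) a = nat_times n a + a"
  by (simp_all add: nat_times_def)

lemma single_power:
  fixes a :: "'a::comm_monoid_add" and c :: "'k::field"
  shows "Poly_Mapping.single a c ^ n = Poly_Mapping.single (nat_times n a) (c ^ n)"
proof (induction n)
  case (Suc n)
  then show ?case by (simp add: mult_single ac_simps)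
qed simp

lemma frobenius_poly_mapping:
  fixes p :: "'a::comm_monoid_add \<Rightarrow>\<^sub>0 'k::field"
  assumes "prime CHAR('k)"
  shows "p ^ CHAR('k) = (\<Sum>a\<in>Poly_Mapping.keys p.
    Poly_Mapping.single (nat_times CHAR('k) a) (Poly_Mapping.lookup p a ^ CHAR('k)))"
proof -
  have "p ^ CHAR('k) =
      (\<Sum>a\<in>Poly_Mapping.keys p. Poly_Mapping.single a (Poly_Mapping.lookup p a)) ^ CHAR('k)"
    by (simp add: poly_mapping_sum_single)
  also have "\<dots> = (\<Sum>a\<in>Poly_Mapping.keys p.
      Poly_Mapping.single a (Poly_Mapping.lookup p a) ^ CHAR('k))"
    by (rule freshmans_dream_sum) (simp_all add: assms)
  finally show ?thesis by (simp add: single_power)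
qed

text \<open>Multiplication by the characteristic may fail to be injective on a monoid, and then
  terms of the power can cancel; hence only an inclusion. This form is applied to the unknown monoid
  M, the equality below to the torsion-free group A.\<close>

lemma keys_frobenius:
  fixes p :: "'a::comm_monoid_add \<Rightarrow>\<^sub>0 'k::field"
  assumes "prime CHAR('k)"
  shows "Poly_Mapping.keys (p ^ CHAR('k)) \<subseteq> nat_times CHAR('k) ` Poly_Mapping.keys p"
  unfolding frobenius_poly_mapping[OF assms]
  by (rule order_trans[OF keys_sum]) (auto split: if_splits)

lemma keys_frobenius_inj:
  fixes p :: "'a::comm_monoid_add \<Rightarrow>\<^sub>0 'k::field"
  assumes "prime CHAR('k)" and inj: "inj (nat_times CHAR('k) :: 'a \<Rightarrow> 'a)"
  shows "Poly_Mapping.keys (p ^ CHAR('k)) = nat_times CHAR('k) ` Poly_Mapping.keys p"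
proof
  show "nat_times CHAR('k) ` Poly_Mapping.keys p \<subseteq> Poly_Mapping.keys (p ^ CHAR('k))"
  proof clarify
    fix b assume b: "b \<in> Poly_Mapping.keys p"
    have "Poly_Mapping.lookup (p ^ CHAR('k)) (nat_times CHAR('k) b)
        = (\<Sum>a\<in>Poly_Mapping.keys p. if a = b then Poly_Mapping.lookup p a ^ CHAR('k) else 0)"
      unfolding frobenius_poly_mapping[OF assms(1)] lookup_sum
      by (rule sum.cong) (auto simp: lookup_single when_def dest: injD[OF inj])
    also have "\<dots> = Poly_Mapping.lookup p b ^ CHAR('k)" using b by simp
    finally show "nat_times CHAR('k) b \<in> Poly_Mapping.keys (p ^ CHAR('k))"
      using b by (simp add: in_keys_iff)
  qed
qed (rule keys_frobenius[OF assms(1)])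

subsection \<open>Leading parts\<close>

abbreviation level_part ::
    "('a \<Rightarrow> 'o) \<Rightarrow> 'o \<Rightarrow> ('a \<Rightarrow>\<^sub>0 'k) \<Rightarrow> ('a \<Rightarrow>\<^sub>0 'k::field)"
  where "level_part v X \<equiv> euler (\<lambda>a. of_bool (v a = X))"

text \<open>The degree \<open>X + Y\<close> is reached only by the product of the two top parts,
  every other pair of terms having smaller degree. That product is assumed nonzero because
  \<open>v\<close> may identify exponents, so a top part can have many terms; for k[M] the
  assumption is checked after transport to k[A].\<close>

lemma top_level_mult:
  fixes v :: "'a::comm_monoid_add \<Rightarrow> 'o::linordered_ab_group_add"
    and x y :: "'a \<Rightarrow>\<^sub>0 'k::field"
  assumes v: "\<And>a b. v (a + b) = v a + v b"
    and X: "\<And>a. a \<in> Poly_Mapping.keys x \<Longrightarrow> v a \<le> X"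
    and Y: "\<And>a. a \<in> Poly_Mapping.keys y \<Longrightarrow> v a \<le> Y"
    and nz: "level_part v X x * level_part v Y y \<noteq> 0"
  shows "\<exists>a\<in>Poly_Mapping.keys (x * y). v a = X + Y"
proof -
  let ?x = "level_part v X x" and ?y = "level_part v Y y"
  obtain a where a: "a \<in> Poly_Mapping.keys (?x * ?y)"
    using nz by (metis all_not_in_conv in_keys_iff lookup_zero poly_mapping_eqI)
  have kx: "v b = X" if "b \<in> Poly_Mapping.keys ?x" for b
    using that by (auto simp: in_keys_iff)
  have ky: "v b = Y" if "b \<in> Poly_Mapping.keys ?y" for b
    using that by (auto simp: in_keys_iff)
  have kx': "v b < X" if "b \<in> Poly_Mapping.keys (x - ?x)" for b
  proof -
    have "v b \<noteq> X" "b \<in> Poly_Mapping.keys x" using that by (auto simp: in_keys_iff lookup_minus)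
    then show ?thesis using X[of b] by simp
  qed
  have ky': "v b < Y" if "b \<in> Poly_Mapping.keys (y - ?y)" for b
  proof -
    have "v b \<noteq> Y" "b \<in> Poly_Mapping.keys y" using that by (auto simp: in_keys_iff lookup_minus)
    then show ?thesis using Y[of b] by simp
  qed
  have va: "v a = X + Y"
  proof -
    obtain b c where "a = b + c" "b \<in> Poly_Mapping.keys ?x" "c \<in> Poly_Mapping.keys ?y"
      using keys_mult[of ?x ?y] a by blast
    then show ?thesis by (metis v kx ky)
  qed
  have "x * y = ?x * ?y + (?x * (y - ?y) + (x - ?x) * y)"
    by (simp add: algebra_simps)
  moreover have "a \<notin> Poly_Mapping.keys (?x * (y - ?y))"
  proof
    assume "a \<in> Poly_Mapping.keys (?x * (y - ?y))"
    then obtain b c where "a = b + c" "b \<in> Poly_Mapping.keys ?x" "c \<in> Poly_Mapping.keys (y - ?y)"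
      using keys_mult[of ?x "y - ?y"] by blast
    then have "v a < X + Y" using add_le_less_mono[OF eq_refl ky', of "v b" X c] kx by (simp add: v)
    then show False using va by simp
  qed
  moreover have "a \<notin> Poly_Mapping.keys ((x - ?x) * y)"
  proof
    assume "a \<in> Poly_Mapping.keys ((x - ?x) * y)"
    then obtain b c where "a = b + c" "b \<in> Poly_Mapping.keys (x - ?x)" "c \<in> Poly_Mapping.keys y"
      using keys_mult[of "x - ?x" y] by blast
    then have "v a < X + Y" using add_less_le_mono[OF kx' Y, of b c] by (simp add: v)
    then show False using va by simp
  qed
  ultimately have "a \<in> Poly_Mapping.keys (x * y)"
    using a by (simp add: in_keys_iff lookup_add)
  then show ?thesis using va by blast
qed

definition top_exponent ::
    "('a \<Rightarrow> 'o::linorder) \<Rightarrow> ('a \<Rightarrow>\<^sub>0 'k::zero) \<Rightarrow> 'o"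
  where "top_exponent v x = Max (v ` Poly_Mapping.keys x)"

lemma top_exponent_ge:
  "a \<in> Poly_Mapping.keys x \<Longrightarrow> v a \<le> top_exponent v x"
  by (simp add: top_exponent_def)

lemma top_exponent_attained:
  assumes "x \<noteq> 0"
  shows "\<exists>a\<in>Poly_Mapping.keys x. v a = top_exponent v x"
proof -
  have "top_exponent v x \<in> v ` Poly_Mapping.keys x"
    unfolding top_exponent_def by (rule Max_in) (use assms in auto)
  then show ?thesis by auto
qed

text \<open>Injectivity of \<open>v\<close> makes each leading part a single monomial, and a product
  of nonzero monomials over a field is nonzero. Taken at \<iota> this makes k[A] a domain; the
  additivity of the leading exponent is what later grades k[M].\<close>

lemma top_exponent_mult:
  fixes v :: "'a::comm_monoid_add \<Rightarrow> 'o::linordered_ab_group_add"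
    and x y :: "'a \<Rightarrow>\<^sub>0 'k::field"
  assumes v: "\<And>a b. v (a + b) = v a + v b" and "inj v" and "x \<noteq> 0" "y \<noteq> 0"
  shows "x * y \<noteq> 0" and "top_exponent v (x * y) = top_exponent v x + top_exponent v y"
proof -
  have single: "\<exists>a. level_part v (top_exponent v z) z = Poly_Mapping.single a (Poly_Mapping.lookup z a)
      \<and> Poly_Mapping.lookup z a \<noteq> 0" if "z \<noteq> 0" for z :: "'a \<Rightarrow>\<^sub>0 'k"
  proof -
    obtain a where a: "a \<in> Poly_Mapping.keys z" "v a = top_exponent v z"
      using top_exponent_attained[OF \<open>z \<noteq> 0\<close>] by blast
    have eq: "v b = top_exponent v z \<longleftrightarrow> b = a" for b
      using a(2) injD[OF \<open>inj v\<close>, of b a] by auto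
    have "level_part v (top_exponent v z) z = Poly_Mapping.single a (Poly_Mapping.lookup z a)"
      by (rule poly_mapping_eqI) (auto simp: eq lookup_single when_def)
    then show ?thesis using a(1) by (auto simp: in_keys_iff)
  qed
  have "level_part v (top_exponent v x) x * level_part v (top_exponent v y) y \<noteq> 0"
  proof -
    obtain a b where ab: "level_part v (top_exponent v x) x * level_part v (top_exponent v y) y
        = Poly_Mapping.single (a + b) (Poly_Mapping.lookup x a * Poly_Mapping.lookup y b)"
      "Poly_Mapping.lookup x a * Poly_Mapping.lookup y b \<noteq> 0"
      using single[OF \<open>x \<noteq> 0\<close>] single[OF \<open>y \<noteq> 0\<close>] by (auto simp: mult_single)
    then show ?thesis by (metis lookup_single_eq lookup_zero)
  qed
  from top_level_mult[OF v top_exponent_ge top_exponent_ge this]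
  obtain a where a: "a \<in> Poly_Mapping.keys (x * y)"
    "v a = top_exponent v x + top_exponent v y" by blast
  then show "x * y \<noteq> 0" by auto
  have "v b \<le> top_exponent v x + top_exponent v y" if b: "b \<in> Poly_Mapping.keys (x * y)" for b
  proof -
    obtain c d where "b = c + d" "c \<in> Poly_Mapping.keys x" "d \<in> Poly_Mapping.keys y"
      using keys_mult[of x y] b by blast
    then show ?thesis by (simp add: v add_mono top_exponent_ge)
  qed
  then show "top_exponent v (x * y) = top_exponent v x + top_exponent v y"
    unfolding top_exponent_def[of v "x * y"]
    using image_eqI[of _ v a, OF a(2)[symmetric] a(1)] by (intro Max_eqI) auto
qed

subsection \<open>Extending derivations from a ring of invariants\<close>

text \<open>The ring sits inside a field so that denominators can be written down, and
  \<open>\<gamma>\<close> is constrained only on \<open>S\<close>. In the application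
  \<open>S\<close> is the image of k[A] in a field of fractions.\<close>

locale cyclic_invariants =
  fixes S :: "'l::field set" and \<gamma> :: "'l \<Rightarrow> 'l" and p :: nat
  assumes zero_S: "0 \<in> S" and one_S: "1 \<in> S"
    and add_S: "s \<in> S \<Longrightarrow> t \<in> S \<Longrightarrow> s + t \<in> S"
    and mult_S: "s \<in> S \<Longrightarrow> t \<in> S \<Longrightarrow> s * t \<in> S"
    and minus_S: "s \<in> S \<Longrightarrow> - s \<in> S"
    and \<gamma>_S: "s \<in> S \<Longrightarrow> \<gamma> s \<in> S"
    and \<gamma>_add: "s \<in> S \<Longrightarrow> t \<in> S \<Longrightarrow> \<gamma> (s + t) = \<gamma> s + \<gamma> t"
    and \<gamma>_mult: "s \<in> S \<Longrightarrow> t \<in> S \<Longrightarrow> \<gamma> (s * t) = \<gamma> s * \<gamma> t"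
    and \<gamma>_one: "\<gamma> 1 = 1"
    and \<gamma>_p: "s \<in> S \<Longrightarrow> (\<gamma> ^^ p) s = s"
    and p_pos: "p > 0"
begin

section \<open>The fixed ring and the polynomials attached to an element\<close>

definition R :: "'l set" where "R = {s \<in> S. \<gamma> s = s}"

definition polys_over :: "'l set \<Rightarrow> 'l poly set"
  where "polys_over X = {P. \<forall>i. coeff P i \<in> X}"

definition conj_factor :: "'l \<Rightarrow> nat \<Rightarrow> 'l poly"
  where "conj_factor \<theta> i = [:- (\<gamma> ^^ i) \<theta>, 1:]"

definition conj_poly :: "'l \<Rightarrow> 'l poly"
  where "conj_poly \<theta> = (\<Prod>i<p. conj_factor \<theta> i)"

text \<open>Lagrange interpolation of the conjugates of \<open>s\<close> with the denominators
  cleared. Since \<open>\<gamma>\<close> permutes the summands cyclically, the coefficients lie in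
  the fixed ring; the value at \<theta> then shows that \<open>different \<theta>\<close> multiplies
  all of \<open>S\<close> into R[\<theta>].\<close>

definition interp_poly :: "'l \<Rightarrow> 'l \<Rightarrow> 'l poly"
  where "interp_poly \<theta> s =
    (\<Sum>i<p. [:(\<gamma> ^^ i) s:] * (\<Prod>h\<in>{..<p} - {i}. conj_factor \<theta> h))"

text \<open>The different of \<theta> over the fixed ring: the derivative of
  \<open>conj_poly \<theta>\<close>, evaluated at \<theta>.\<close>

definition different :: "'l \<Rightarrow> 'l"
  where "different \<theta> = (\<Prod>i\<in>{1..<p}. \<theta> - (\<gamma> ^^ i) \<theta>)"

definition derivation_on :: "'l set \<Rightarrow> ('l \<Rightarrow> 'l) \<Rightarrow> bool"
  where "derivation_on X D \<longleftrightarrow> (\<forall>s\<in>X. \<forall>t\<in>X. D (s + t) = D s + D t \<and> D (s * t) = D s * t + s * D t)"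

lemma \<gamma>_0: "\<gamma> 0 = 0"
  using \<gamma>_add[OF zero_S zero_S] by (metis add.right_neutral add_cancel_left_left)

lemma \<gamma>_uminus: "s \<in> S \<Longrightarrow> \<gamma> (- s) = - \<gamma> s"
  using \<gamma>_add[of s "- s"] minus_S[of s] by (simp add: \<gamma>_0 eq_neg_iff_add_eq_0 add.commute)

lemma \<gamma>_pow_S: "s \<in> S \<Longrightarrow> (\<gamma> ^^ i) s \<in> S"
  by (induction i) (auto intro: \<gamma>_S)

lemma \<gamma>_pow_R: "s \<in> R \<Longrightarrow> (\<gamma> ^^ i) s = s"
  by (induction i) (simp_all add: R_def)

lemma sum_S: "(\<And>x. x \<in> A \<Longrightarrow> h x \<in> S) \<Longrightarrow> sum h A \<in> S"
  by (induction A rule: infinite_finite_induct) (auto intro: zero_S add_S)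

lemma prod_S: "(\<And>x. x \<in> A \<Longrightarrow> h x \<in> S) \<Longrightarrow> prod h A \<in> S"
  by (induction A rule: infinite_finite_induct) (auto intro: one_S mult_S)

lemma diff_S: "s \<in> S \<Longrightarrow> t \<in> S \<Longrightarrow> s - t \<in> S"
  using add_S[of s "- t"] minus_S[of t] by simp

lemma \<gamma>_sum: "(\<And>x. x \<in> A \<Longrightarrow> h x \<in> S) \<Longrightarrow> \<gamma> (sum h A) = (\<Sum>x\<in>A. \<gamma> (h x))"
  by (induction A rule: infinite_finite_induct) (auto simp: \<gamma>_0 \<gamma>_add sum_S)

lemma R_subset: "R \<subseteq> S"
  and zero_R: "0 \<in> R" and one_R: "1 \<in> R"
  and add_R: "s \<in> R \<Longrightarrow> t \<in> R \<Longrightarrow> s + t \<in> R"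
  and mult_R: "s \<in> R \<Longrightarrow> t \<in> R \<Longrightarrow> s * t \<in> R"
  and minus_R: "s \<in> R \<Longrightarrow> - s \<in> R"
  by (auto simp: R_def zero_S one_S \<gamma>_0 \<gamma>_one add_S mult_S minus_S \<gamma>_add \<gamma>_mult \<gamma>_uminus)

lemma sum_R: "(\<And>x. x \<in> A \<Longrightarrow> h x \<in> R) \<Longrightarrow> sum h A \<in> R"
  by (induction A rule: infinite_finite_induct) (auto intro: zero_R add_R)

lemma polys_over_mult:
  "P \<in> polys_over S \<Longrightarrow> Q \<in> polys_over S \<Longrightarrow> P * Q \<in> polys_over S"
  "P \<in> polys_over R \<Longrightarrow> Q \<in> polys_over R \<Longrightarrow> P * Q \<in> polys_over R"
  by (auto simp: polys_over_def coeff_mult intro!: sum_S mult_S sum_R mult_R)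

lemma polys_over_add_R:
  "P \<in> polys_over R \<Longrightarrow> Q \<in> polys_over R \<Longrightarrow> P + Q \<in> polys_over R"
  "P \<in> polys_over R \<Longrightarrow> Q \<in> polys_over R \<Longrightarrow> P - Q \<in> polys_over R"
  using add_R minus_R by (auto simp: polys_over_def) (metis add_R minus_R diff_conv_add_uminus)

lemma polys_over_const: "0 \<in> X \<Longrightarrow> s \<in> X \<Longrightarrow> [:s:] \<in> polys_over X"
  by (auto simp: polys_over_def coeff_pCons split: nat.split)

lemma polys_over_monom: "s \<in> R \<Longrightarrow> monom s n \<in> polys_over R"
  by (auto simp: polys_over_def zero_R)

lemma polys_over_conj_factor: "\<theta> \<in> S \<Longrightarrow> conj_factor \<theta> i \<in> polys_over S"
  by (auto simp: polys_over_def conj_factor_def coeff_pCons zero_S one_S minus_S \<gamma>_pow_S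
      split: nat.split)

lemma polys_over_prod:
  "(\<And>x. x \<in> A \<Longrightarrow> h x \<in> polys_over S) \<Longrightarrow> prod h A \<in> polys_over S"
proof (induction A rule: infinite_finite_induct)
  case (insert x F)
  then show ?case by (simp add: polys_over_mult)
qed (auto simp: one_pCons intro!: polys_over_const zero_S one_S)

lemma map_poly_\<gamma>_mult:
  assumes "P \<in> polys_over S" "Q \<in> polys_over S"
  shows "map_poly \<gamma> (P * Q) = map_poly \<gamma> P * map_poly \<gamma> Q"
proof (rule poly_eqI)
  fix n
  show "coeff (map_poly \<gamma> (P * Q)) n = coeff (map_poly \<gamma> P * map_poly \<gamma> Q) n"
    using assms
    by (simp add: coeff_map_poly \<gamma>_0 coeff_mult polys_over_def \<gamma>_sum mult_S \<gamma>_mult)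
qed

lemma map_poly_\<gamma>_prod:
  "(\<And>x. x \<in> A \<Longrightarrow> h x \<in> polys_over S) \<Longrightarrow>
    map_poly \<gamma> (prod h A) = (\<Prod>x\<in>A. map_poly \<gamma> (h x))"
proof (induction A rule: infinite_finite_induct)
  case (insert x F)
  then show ?case by (simp add: polys_over_prod map_poly_\<gamma>_mult)
qed (simp_all add: one_pCons map_poly_pCons \<gamma>_one \<gamma>_0)

lemma map_poly_\<gamma>_sum:
  assumes "\<And>x. x \<in> A \<Longrightarrow> h x \<in> polys_over S"
  shows "map_poly \<gamma> (sum h A) = (\<Sum>x\<in>A. map_poly \<gamma> (h x))"
proof (rule poly_eqI)
  fix n
  show "coeff (map_poly \<gamma> (sum h A)) n = coeff (\<Sum>x\<in>A. map_poly \<gamma> (h x)) n"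
    using assms by (simp add: coeff_map_poly \<gamma>_0 coeff_sum polys_over_def \<gamma>_sum)
qed

lemma \<gamma>_pow_mod: "s \<in> S \<Longrightarrow> (\<gamma> ^^ (Suc i mod p)) s = \<gamma> ((\<gamma> ^^ i) s)" if "i < p"
  using that \<gamma>_p[of s] by (cases "Suc i = p") auto

lemma shift_bij: "bij_betw (\<lambda>i. Suc i mod p) {..<p} {..<p}"
proof (rule bij_betwI')
  fix x y assume "x \<in> {..<p}" "y \<in> {..<p}"
  then show "(Suc x mod p = Suc y mod p) = (x = y)"
    by (auto simp: mod_Suc)
next
  fix y assume "y \<in> {..<p}"
  then show "\<exists>x\<in>{..<p}. y = Suc x mod p"
    by (cases y) (auto intro: bexI[of _ "p - 1"] bexI[of _ "y - 1"])
qed (use p_pos in auto)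

lemma map_poly_conj_factor:
  "i < p \<Longrightarrow> \<theta> \<in> S \<Longrightarrow> map_poly \<gamma> (conj_factor \<theta> i) = conj_factor \<theta> (Suc i mod p)"
  by (simp add: conj_factor_def map_poly_pCons \<gamma>_0 \<gamma>_one \<gamma>_uminus \<gamma>_pow_S \<gamma>_pow_mod)

lemma map_poly_fixed:
  assumes "P \<in> polys_over S" "map_poly \<gamma> P = P"
  shows "P \<in> polys_over R"
proof -
  have "\<gamma> (coeff P i) = coeff P i" for i
    using coeff_map_poly[of \<gamma> P i, OF \<gamma>_0] assms(2) by simp
  then show ?thesis using assms(1) by (simp add: polys_over_def R_def)
qed

lemma conj_poly_over_R:
  assumes "\<theta> \<in> S"
  shows "conj_poly \<theta> \<in> polys_over R"
proof (rule map_poly_fixed)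
  show "conj_poly \<theta> \<in> polys_over S"
    unfolding conj_poly_def by (intro polys_over_prod polys_over_conj_factor assms)
  have "map_poly \<gamma> (conj_poly \<theta>) = (\<Prod>i<p. conj_factor \<theta> (Suc i mod p))"
    using assms unfolding conj_poly_def
    by (subst map_poly_\<gamma>_prod) (auto simp: polys_over_conj_factor map_poly_conj_factor)
  also have "\<dots> = conj_poly \<theta>"
    unfolding conj_poly_def using prod.reindex_bij_betw[OF shift_bij] .
  finally show "map_poly \<gamma> (conj_poly \<theta>) = conj_poly \<theta>" .
qed

lemma interp_poly_over_R:
  assumes "\<theta> \<in> S" "s \<in> S"
  shows "interp_poly \<theta> s \<in> polys_over R"
proof (rule map_poly_fixed)
  let ?\<sigma> = "\<lambda>i. Suc i mod p"
  let ?h = "\<lambda>i. [:(\<gamma> ^^ i) s:] * (\<Prod>h\<in>{..<p} - {i}. conj_factor \<theta> h)"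
  have h: "?h i \<in> polys_over S" for i
    by (intro polys_over_mult polys_over_prod polys_over_conj_factor polys_over_const zero_S
        \<gamma>_pow_S assms)
  then show "interp_poly \<theta> s \<in> polys_over S"
    unfolding interp_poly_def by (auto simp: polys_over_def coeff_sum intro!: sum_S)
  have shift: "map_poly \<gamma> (?h i) = ?h (?\<sigma> i)" if "i < p" for i
  proof -
    have "map_poly \<gamma> (?h i) = [:(\<gamma> ^^ ?\<sigma> i) s:] * (\<Prod>h\<in>{..<p} - {i}. conj_factor \<theta> (?\<sigma> h))"
      using that assms
      by (subst map_poly_\<gamma>_mult)
        (auto simp: polys_over_prod polys_over_conj_factor polys_over_const zero_S \<gamma>_pow_S
          map_poly_\<gamma>_prod map_poly_conj_factor map_poly_pCons \<gamma>_0 \<gamma>_pow_mod)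
    moreover have "bij_betw ?\<sigma> ({..<p} - {i}) ({..<p} - {?\<sigma> i})"
      using bij_betw_DiffI[OF shift_bij, of "{i}" "{?\<sigma> i}"] that p_pos by auto
    ultimately show ?thesis
      by (simp add: prod.reindex_bij_betw[of ?\<sigma> _ _ "conj_factor \<theta>"])
  qed
  have "map_poly \<gamma> (interp_poly \<theta> s) = (\<Sum>i<p. ?h (?\<sigma> i))"
    unfolding interp_poly_def using h shift by (subst map_poly_\<gamma>_sum) auto
  also have "\<dots> = interp_poly \<theta> s"
    unfolding interp_poly_def using sum.reindex_bij_betw[OF shift_bij, of ?h] .
  finally show "map_poly \<gamma> (interp_poly \<theta> s) = interp_poly \<theta> s" .
qed

lemma poly_conj_factor [simp]: "poly (conj_factor \<theta> i) x = x - (\<gamma> ^^ i) \<theta>"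
  by (simp add: conj_factor_def)

lemma index_split: "{..<p} = insert 0 {1..<p}"
  using p_pos by auto

lemma poly_interp_poly: "poly (interp_poly \<theta> s) \<theta> = s * different \<theta>"
proof -
  have "poly (interp_poly \<theta> s) \<theta> = (\<Sum>i<p. (\<gamma> ^^ i) s * (\<Prod>h\<in>{..<p} - {i}. \<theta> - (\<gamma> ^^ h) \<theta>))"
    by (simp add: interp_poly_def poly_sum poly_prod)
  also have "\<dots> = (\<Sum>i<p. if i = 0 then s * different \<theta> else 0)"
  proof (rule sum.cong)
    fix i assume i: "i \<in> {..<p}"
    show "(\<gamma> ^^ i) s * (\<Prod>h\<in>{..<p} - {i}. \<theta> - (\<gamma> ^^ h) \<theta>) = (if i = 0 then s * different \<theta> else 0)"
    proof (cases "i = 0")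
      case True
      moreover have "{..<p} - {0} = {1..<p}" by auto
      ultimately show ?thesis by (simp add: different_def)
    next
      case False
      then have "(\<Prod>h\<in>{..<p} - {i}. \<theta> - (\<gamma> ^^ h) \<theta>) = 0"
        using p_pos by (intro prod_zero) (auto intro!: bexI[of _ 0])
      then show ?thesis using False by simp
    qed
  qed simp
  also have "\<dots> = s * different \<theta>" using p_pos by simp
  finally show ?thesis .
qed

lemma poly_conj_poly: "poly (conj_poly \<theta>) \<theta> = 0"
  unfolding conj_poly_def index_split by (simp add: poly_prod)

lemma poly_pderiv_conj_poly: "poly (pderiv (conj_poly \<theta>)) \<theta> = different \<theta>"
proof -
  have "conj_poly \<theta> = conj_factor \<theta> 0 * (\<Prod>i\<in>{1..<p}. conj_factor \<theta> i)"
    unfolding conj_poly_def index_split by simp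
  then show ?thesis
    by (simp add: pderiv_mult poly_prod different_def) (simp add: conj_factor_def pderiv_pCons)
qed

lemma degree_conj_poly: "degree (conj_poly \<theta>) = p" "coeff (conj_poly \<theta>) p = 1"
proof -
  have nz: "conj_factor \<theta> i \<noteq> 0" for i by (simp add: conj_factor_def)
  show deg: "degree (conj_poly \<theta>) = p"
    unfolding conj_poly_def by (subst degree_prod_eq_sum_degree) (auto simp: conj_factor_def)
  have "lead_coeff (conj_poly \<theta>) = 1"
    unfolding conj_poly_def by (simp add: lead_coeff_prod conj_factor_def)
  then show "coeff (conj_poly \<theta>) p = 1" by (simp add: deg)
qed

lemma poly_\<gamma>_pow:
  assumes "P \<in> polys_over R" "\<theta> \<in> S"
  shows "poly P ((\<gamma> ^^ i) \<theta>) = (\<gamma> ^^ i) (poly P \<theta>)"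
proof (induction i)
  case (Suc i)
  have step: "poly P x \<in> S \<and> poly P (\<gamma> x) = \<gamma> (poly P x)" if "x \<in> S" for x
    using assms(1)
  proof (induction P)
    case (pCons a P)
    have "coeff (pCons a P) 0 \<in> R" "coeff (pCons a P) (Suc i) \<in> R" for i
      using pCons.prems unfolding polys_over_def by blast+
    then have "a \<in> R" "P \<in> polys_over R" by (simp_all add: polys_over_def)
    then show ?case
      using pCons.IH that
      by (simp add: R_def add_S mult_S \<gamma>_add \<gamma>_mult \<gamma>_S)
  qed (simp add: zero_S \<gamma>_0)
  show ?case using step[OF \<gamma>_pow_S[OF assms(2), of i]] Suc.IH by simp
qed simp

lemma eval_in_S:
  assumes "\<And>i. coeff P i \<in> S" "\<theta> \<in> S"
  shows "poly P \<theta> \<in> S"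
proof -
  have "\<theta> ^ n \<in> S" for n by (induction n) (auto intro: one_S mult_S assms)
  then show ?thesis unfolding poly_altdef using assms by (auto intro!: sum_S mult_S)
qed

section \<open>Derivations and their denominators\<close>

context
  fixes D :: "'l \<Rightarrow> 'l"
  assumes D: "derivation_on R D"
begin

lemma D_0: "D 0 = 0"
  using D zero_R unfolding derivation_on_def by (metis add.right_neutral add_cancel_left_left)

lemma D_sum: "(\<And>x. x \<in> A \<Longrightarrow> h x \<in> R) \<Longrightarrow> D (sum h A) = (\<Sum>x\<in>A. D (h x))"
proof (induction A rule: infinite_finite_induct)
  case (insert x F)
  then have "h x \<in> R" "sum h F \<in> R" by (auto intro: sum_R)
  then show ?case using D insert by (simp add: derivation_on_def)
qed (auto simp: D_0)

lemma map_poly_D_add: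
  assumes "P \<in> polys_over R" "Q \<in> polys_over R"
  shows "map_poly D (P + Q) = map_poly D P + map_poly D Q"
  using assms D by (intro poly_eqI) (simp add: coeff_map_poly D_0 polys_over_def derivation_on_def)

lemma map_poly_D_mult:
  assumes "P \<in> polys_over R" "Q \<in> polys_over R"
  shows "map_poly D (P * Q) = map_poly D P * Q + P * map_poly D Q"
proof (rule poly_eqI)
  fix n
  have "D (\<Sum>i\<le>n. coeff P i * coeff Q (n - i)) =
      (\<Sum>i\<le>n. D (coeff P i * coeff Q (n - i)))"
    using assms by (intro D_sum) (auto simp: polys_over_def mult_R)
  also have "\<dots> = (\<Sum>i\<le>n. D (coeff P i) * coeff Q (n - i) + coeff P i * D (coeff Q (n - i)))"
    using assms D by (simp add: polys_over_def derivation_on_def)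
  finally show "coeff (map_poly D (P * Q)) n = coeff (map_poly D P * Q + P * map_poly D Q) n"
    by (simp add: coeff_map_poly D_0 coeff_mult sum.distrib)
qed

text \<open>The chain rule: what an extension of \<open>D\<close> sending \<theta> to
  \<open>d\<close> must do to the value of \<open>P\<close> at \<theta>. It is defined on
  polynomials, since dependence on that value alone has yet to be proved.\<close>

definition poly_derivation :: "'l \<Rightarrow> 'l \<Rightarrow> 'l poly \<Rightarrow> 'l"
  where "poly_derivation \<theta> d P = poly (map_poly D P) \<theta> + poly (pderiv P) \<theta> * d"

lemma poly_derivation_add:
  assumes "P \<in> polys_over R" "Q \<in> polys_over R"
  shows "poly_derivation \<theta> d (P + Q) = poly_derivation \<theta> d P + poly_derivation \<theta> d Q"
  by (simp add: poly_derivation_def map_poly_D_add[OF assms] pderiv_add algebra_simps)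

lemma poly_derivation_mult:
  assumes "P \<in> polys_over R" "Q \<in> polys_over R"
  shows "poly_derivation \<theta> d (P * Q) =
    poly_derivation \<theta> d P * poly Q \<theta> + poly P \<theta> * poly_derivation \<theta> d Q"
  by (simp add: poly_derivation_def map_poly_D_mult[OF assms] pderiv_mult algebra_simps)

lemma poly_derivation_const: "poly_derivation \<theta> d [:r:] = D r"
  by (simp add: poly_derivation_def map_poly_pCons D_0)

context
  fixes \<theta> :: 'l
  assumes \<theta>: "\<theta> \<in> S" and reg: "inj_on (\<lambda>i. (\<gamma> ^^ i) \<theta>) {..<p}"
begin

lemma different_nz: "different \<theta> \<noteq> 0"
proof -
  have "\<theta> \<noteq> (\<gamma> ^^ i) \<theta>" if "i \<in> {1..<p}" for i
    using inj_onD[OF reg, of 0 i] that by auto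
  then show ?thesis by (auto simp: different_def)
qed

text \<open>Forced by differentiating the equation
  \<open>poly (conj_poly \<theta>) \<theta> = 0\<close>; the denominator is nonzero because the
  conjugates of \<theta> are distinct.\<close>

definition root_derivative :: 'l
  where "root_derivative = - poly (map_poly D (conj_poly \<theta>)) \<theta> / different \<theta>"

abbreviation "\<Delta> \<equiv> poly_derivation \<theta> root_derivative"

lemma \<Delta>_conj_poly: "\<Delta> (conj_poly \<theta>) = 0"
  by (simp add: poly_derivation_def poly_pderiv_conj_poly root_derivative_def different_nz)

text \<open>Well-definedness of the extension on R[\<theta>]. Multiples of the monic
  \<open>conj_poly \<theta>\<close> are killed by \<open>\<Delta>\<close>, so division by it reduces
  to degree below p; there a polynomial over \<open>R\<close> with root \<theta> has all p
  conjugates as roots and is 0.\<close>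

lemma \<Delta>_eq_0:
  assumes "P \<in> polys_over R" "poly P \<theta> = 0"
  shows "\<Delta> P = 0"
proof -
  have "\<Delta> P = 0" if "P \<in> polys_over R" "poly P \<theta> = 0" "\<And>i. i \<ge> n \<Longrightarrow> coeff P i = 0" for n P
    using that
  proof (induction n arbitrary: P)
    case 0
    then have "P = 0" by (auto intro: poly_eqI)
    then show ?case by (simp add: poly_derivation_def)
  next
    case (Suc n)
    show ?case
    proof (cases "n < p")
      case True
      have "P = 0"
      proof (rule ccontr)
        assume nz: "P \<noteq> 0"
        have "(\<gamma> ^^ i) \<theta> \<in> {x. poly P x = 0}" for i
          using poly_\<gamma>_pow[OF Suc.prems(1) \<theta>, of i] Suc.prems(2) \<gamma>_pow_R[OF zero_R]
          by simp
        then have "(\<lambda>i. (\<gamma> ^^ i) \<theta>) ` {..<p} \<subseteq> {x. poly P x = 0}" by blast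
        then have "p \<le> card {x. poly P x = 0}"
          using card_mono[OF poly_roots_finite[OF nz], of "(\<lambda>i. (\<gamma> ^^ i) \<theta>) ` {..<p}"]
          unfolding card_image[OF reg] by simp
        also have "\<dots> \<le> degree P" using nz by (rule card_poly_roots_bound)
        also have "\<dots> \<le> n" using Suc.prems(3) by (intro degree_le) auto
        finally show False using True by simp
      qed
      then show ?thesis by (simp add: poly_derivation_def)
    next
      case False
      \<comment> \<open>As \<open>conj_poly \<theta>\<close> is monic, \<open>Q\<close> cancels the
        term of degree \<open>n\<close> without any division in \<open>R\<close>.\<close>
      define Q where "Q = monom (coeff P n) (n - p) * conj_poly \<theta>"
      have m: "monom (coeff P n) (n - p) \<in> polys_over R"
        using Suc.prems(1) by (intro polys_over_monom) (auto simp: polys_over_def)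
      then have Q: "Q \<in> polys_over R"
        unfolding Q_def by (intro polys_over_mult conj_poly_over_R \<theta>)
      have \<Delta>Q: "\<Delta> Q = 0"
        unfolding Q_def by (simp add: poly_derivation_mult[OF m conj_poly_over_R[OF \<theta>]]
            poly_conj_poly \<Delta>_conj_poly)
      have PQ: "P - Q \<in> polys_over R" by (intro polys_over_add_R Suc.prems Q)
      have "\<Delta> (P - Q) = 0"
      proof (rule Suc.IH)
        show "P - Q \<in> polys_over R" by (fact PQ)
        show "poly (P - Q) \<theta> = 0" by (simp add: Suc.prems(2) Q_def poly_conj_poly)
        fix i assume "n \<le> i"
        have Qi: "coeff Q i = coeff P n * coeff (conj_poly \<theta>) (i - (n - p))"
          using \<open>n \<le> i\<close> unfolding Q_def coeff_monom_mult by simp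
        show "coeff (P - Q) i = 0"
        proof (cases "i = n")
          case True
          then have "i - (n - p) = p" using False by simp
          then show ?thesis using Qi True by (simp add: degree_conj_poly)
        next
          case neq: False
          then have "p < i - (n - p)" using False \<open>n \<le> i\<close> by linarith
          then have "coeff (conj_poly \<theta>) (i - (n - p)) = 0"
            by (intro coeff_eq_0) (simp add: degree_conj_poly)
          then show ?thesis using Qi neq \<open>n \<le> i\<close> Suc.prems(3)[of i] by simp
        qed
      qed
      then show ?thesis using poly_derivation_add[OF PQ Q] \<Delta>Q by simp
    qed
  qed
  from this[of P "Suc (degree P)"] show ?thesis using assms by (simp add: coeff_eq_0)
qed

lemma \<Delta>_cong:
  assumes "P \<in> polys_over R" "Q \<in> polys_over R" "poly P \<theta> = poly Q \<theta>"
  shows "\<Delta> P = \<Delta> Q"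
proof -
  have "\<Delta> (P - Q) = 0"
    using assms by (intro \<Delta>_eq_0 polys_over_add_R) auto
  then show ?thesis
    using poly_derivation_add[OF polys_over_add_R(2)[OF assms(1,2)] assms(2)] by simp
qed

text \<open>The quotient rule, with \<open>s\<close> written as the value of
  \<open>interp_poly \<theta> s\<close> at \<theta> over that of
  \<open>interp_poly \<theta> 1\<close>, which is \<open>different \<theta>\<close>.\<close>

definition extension :: "'l \<Rightarrow> 'l"
  where "extension s = (\<Delta> (interp_poly \<theta> s) - s * \<Delta> (interp_poly \<theta> 1)) / different \<theta>"

lemma extension_derivation: "derivation_on S extension"
  unfolding derivation_on_def
proof (intro ballI conjI)
  fix s t assume s: "s \<in> S" and t: "t \<in> S"
  note L = interp_poly_over_R[OF \<theta>]
  let ?L = "interp_poly \<theta>" and ?c = "different \<theta>"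
  have "\<Delta> (?L (s + t)) = \<Delta> (?L s + ?L t)"
    by (intro \<Delta>_cong L polys_over_add_R s t add_S) (simp add: poly_interp_poly algebra_simps)
  then show "extension (s + t) = extension s + extension t"
    by (simp add: extension_def poly_derivation_add[OF L[OF s] L[OF t]] algebra_simps
        add_divide_distrib diff_divide_distrib)
  \<comment> \<open>Both products take the value \<open>s * t * ?c ^ 2\<close> at \<theta>.
    Comparing their derivatives and cancelling \<open>?c\<close> yields the Leibniz rule.\<close>
  have "\<Delta> (?L 1 * ?L (s * t)) = \<Delta> (?L s * ?L t)"
    by (intro \<Delta>_cong L polys_over_mult s t mult_S one_S) (simp add: poly_interp_poly)
  then have "\<Delta> (?L 1) * (s * t * ?c) + ?c * \<Delta> (?L (s * t)) =
      \<Delta> (?L s) * (t * ?c) + s * ?c * \<Delta> (?L t)"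
    by (simp add: poly_derivation_mult L s t mult_S one_S poly_interp_poly)
  then have "?c * \<Delta> (?L (s * t)) = ?c * (\<Delta> (?L s) * t + s * \<Delta> (?L t) - \<Delta> (?L 1) * (s * t))"
    by (simp add: algebra_simps)
  then have st: "\<Delta> (?L (s * t)) = \<Delta> (?L s) * t + s * \<Delta> (?L t) - \<Delta> (?L 1) * (s * t)"
    using different_nz by simp
  have ext: "extension x * ?c = \<Delta> (?L x) - x * \<Delta> (?L 1)" for x
    using different_nz by (simp add: extension_def)
  have "extension (s * t) * ?c = (extension s * ?c) * t + s * (extension t * ?c)"
    unfolding ext st by (simp add: algebra_simps)
  also have "\<dots> = (extension s * t + s * extension t) * ?c"
    by (simp add: algebra_simps)
  finally show "extension (s * t) = extension s * t + s * extension t"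
    using different_nz by simp
qed

lemma extension_extends: "extension r = D r" if r: "r \<in> R"
proof -
  note L = interp_poly_over_R[OF \<theta>]
  have rS: "r \<in> S" using r R_subset by blast
  have c: "[:r:] \<in> polys_over R" using r zero_R by (rule polys_over_const[rotated])
  have "\<Delta> (interp_poly \<theta> r) = \<Delta> (interp_poly \<theta> 1 * [:r:])"
    by (intro \<Delta>_cong L polys_over_mult rS one_S c) (simp add: poly_interp_poly)
  also have "\<dots> = \<Delta> (interp_poly \<theta> 1) * r + different \<theta> * D r"
    unfolding poly_derivation_mult[OF L[OF one_S] c] poly_derivation_const
    by (simp add: poly_interp_poly)
  finally show ?thesis
    using different_nz by (simp add: extension_def)
qed

text \<open>Here \<open>E\<close> is any extension of \<open>D\<close>, not necessarily the one
  built from \<theta>, so that one \<open>E\<close> can be bounded by several \<theta>. One factor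
  \<open>different \<theta>\<close> clears the denominator of \<open>E \<theta>\<close>, the other
  moves \<open>s\<close> into R[\<theta>].\<close>

lemma denominator_bound:
  assumes E: "derivation_on S E" and ext: "\<And>r. r \<in> R \<Longrightarrow> E r = D r"
    and DR: "\<And>r. r \<in> R \<Longrightarrow> D r \<in> S" and s: "s \<in> S"
  shows "E s * different \<theta> ^ 2 \<in> S"
proof -
  let ?c = "different \<theta>"
  have E_add: "E (x + y) = E x + E y" and E_mult: "E (x * y) = E x * y + x * E y"
    if "x \<in> S" "y \<in> S" for x y
    using E that by (auto simp: derivation_on_def)
  have chain: "poly P \<theta> \<in> S \<and> E (poly P \<theta>) = poly_derivation \<theta> (E \<theta>) P" if "P \<in> polys_over R" for P
    using that
  proof (induction P)
    case (pCons a P)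
    have "coeff (pCons a P) 0 \<in> R" "coeff (pCons a P) (Suc i) \<in> R" for i
      using pCons.prems unfolding polys_over_def by blast+
    then have a: "a \<in> R" "P \<in> polys_over R" by (simp_all add: polys_over_def)
    then have IH: "poly P \<theta> \<in> S" "E (poly P \<theta>) = poly_derivation \<theta> (E \<theta>) P" and aS: "a \<in> S"
      using pCons.IH R_subset by auto
    have "E (a + \<theta> * poly P \<theta>) = D a + (E \<theta> * poly P \<theta> + \<theta> * poly_derivation \<theta> (E \<theta>) P)"
      using E_add[OF aS mult_S[OF \<theta> IH(1)]] E_mult[OF \<theta> IH(1)] ext[OF a(1)] IH(2) by metis
    also have "\<dots> = poly_derivation \<theta> (E \<theta>) (pCons a P)"
      unfolding poly_derivation_def map_poly_pCons[of D, OF D_0] pderiv_pCons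
      by (simp add: algebra_simps)
    finally show ?case using add_S[OF aS mult_S[OF \<theta> IH(1)]] by simp
  next
    case 0
    show ?case using ext[OF zero_R] by (simp add: zero_S D_0 poly_derivation_def)
  qed
  have D_eval: "poly (map_poly D P) \<theta> \<in> S" if "P \<in> polys_over R" for P
    using that DR by (intro eval_in_S \<theta>) (auto simp: coeff_map_poly D_0 polys_over_def)
  have of_nat_S: "of_nat n \<in> S" for n
    by (induction n) (auto intro: zero_S one_S add_S)
  have P'_eval: "poly (pderiv P) \<theta> \<in> S" if "P \<in> polys_over R" for P
    using that R_subset
    by (intro eval_in_S \<theta>) (auto simp: coeff_pderiv polys_over_def intro!: mult_S add_S one_S of_nat_S)
  have cS: "?c \<in> S"
    unfolding different_def by (intro prod_S diff_S \<gamma>_pow_S \<theta>)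
  have "E \<theta> * ?c = - poly (map_poly D (conj_poly \<theta>)) \<theta>"
    using chain[OF conj_poly_over_R[OF \<theta>]] ext[OF zero_R]
    by (simp add: poly_conj_poly D_0 poly_derivation_def poly_pderiv_conj_poly
        eq_neg_iff_add_eq_0 algebra_simps)
  then have E\<theta>: "E \<theta> * ?c \<in> S"
    using D_eval[OF conj_poly_over_R[OF \<theta>]] minus_S by simp
  have key: "E (t * ?c) * ?c \<in> S" if t: "t \<in> S" for t
  proof -
    note L = interp_poly_over_R[OF \<theta> t]
    have "E (t * ?c) * ?c = poly (map_poly D (interp_poly \<theta> t)) \<theta> * ?c
        + poly (pderiv (interp_poly \<theta> t)) \<theta> * (E \<theta> * ?c)"
      using chain[OF L] by (simp add: poly_interp_poly poly_derivation_def algebra_simps)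
    then show ?thesis
      using D_eval[OF L] P'_eval[OF L] cS E\<theta> by (auto intro!: add_S mult_S)
  qed
  \<comment> \<open>The unwanted derivative of \<open>?c\<close> is itself covered by the bound
    \<open>key\<close> at \<open>t = 1\<close>.\<close>
  have "E s * ?c ^ 2 = E (s * ?c) * ?c - s * (E (1 * ?c) * ?c)"
    using s cS by (simp add: E_mult power2_eq_square algebra_simps)
  then show ?thesis
    using key[OF s] key[OF one_S] s by (auto intro!: diff_S mult_S)
qed

end
end
end

subsection \<open>Lattices with an automorphism of odd prime order\<close>

lemma power_odd_inj: "\<beta> ^ p = (- \<alpha>) ^ p \<Longrightarrow> odd p \<Longrightarrow> \<beta> = - \<alpha>" for \<alpha> \<beta> :: int
  by (metis odd_pos odd_real_root_unique of_int_eq_iff of_int_power)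

text \<open>\<iota> identifies A with Z^n, written as integer functions supported in
  \<open>{..<n}\<close>. That type carries a linear order compatible with addition, so \<iota>
  supplies coordinates and leading exponents at once.\<close>

locale lattice_action =
  fixes \<iota> :: "'a::ab_group_add \<Rightarrow> (nat \<Rightarrow>\<^sub>0 int)" and n :: nat and g :: "'a \<Rightarrow> 'a" and p :: nat
  assumes \<iota>_add: "\<iota> (a + b) = \<iota> a + \<iota> b"
    and inj_\<iota>: "inj \<iota>"
    and range_\<iota>: "range \<iota> = {x. Poly_Mapping.keys x \<subseteq> {..<n}}"
    and g_add: "g (a + b) = g a + g b"
    and g_p: "(g ^^ p) a = a"
    and g_nontrivial: "\<exists>a. g a \<noteq> a"
    and prime_p: "prime p" and odd_p: "odd p"
begin

lemma \<iota>_0 [simp]: "\<iota> 0 = 0"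
  using \<iota>_add[of 0 0] by (metis add.right_neutral add_cancel_left_left)

lemma \<iota>_uminus: "\<iota> (- a) = - \<iota> a"
  using \<iota>_add[of a "- a"] by (simp add: eq_neg_iff_add_eq_0 add.commute)

abbreviation coord :: "'a \<Rightarrow> nat \<Rightarrow> int"
  where "coord a \<equiv> Poly_Mapping.lookup (\<iota> a)"

lemma coord_0 [simp]: "coord 0 k = 0"
  and coord_add [simp]: "coord (a + b) k = coord a k + coord b k"
  and coord_uminus [simp]: "coord (- a) k = - coord a k"
  by (simp_all add: \<iota>_add \<iota>_uminus lookup_add)

lemma coord_diff [simp]: "coord (a - b) k = coord a k - coord b k"
  using coord_add[of a "- b" k] by simp

lemma coord_eqI: "(\<And>k. coord a k = coord b k) \<Longrightarrow> a = b"
  using inj_\<iota> by (meson injD poly_mapping_eqI)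

definition int_times :: "int \<Rightarrow> 'a \<Rightarrow> 'a"
  where "int_times s a = inv_into UNIV \<iota> (frag_cmul s (\<iota> a))"

lemma \<iota>_int_times: "\<iota> (int_times s a) = frag_cmul s (\<iota> a)"
proof -
  have "Poly_Mapping.keys (\<iota> a) \<subseteq> {..<n}" using range_\<iota> by blast
  then have "Poly_Mapping.keys (frag_cmul s (\<iota> a)) \<subseteq> {..<n}"
    using keys_cmul by blast
  then have "frag_cmul s (\<iota> a) \<in> range \<iota>" unfolding range_\<iota> by blast
  then show ?thesis unfolding int_times_def by (rule f_inv_into_f)
qed

lemma coord_int_times [simp]: "coord (int_times s a) k = s * coord a k"
  by (simp add: \<iota>_int_times)

lemma coord_nat_times [simp]: "coord (nat_times m a) k = int m * coord a k"
  by (induction m) (simp_all add: algebra_simps)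

lemma coord_sum [simp]: "coord (sum h X) k = (\<Sum>x\<in>X. coord (h x) k)"
  by (induction X rule: infinite_finite_induct) simp_all

lemma int_times_eq_0: "int_times s a = 0 \<longleftrightarrow> s = 0 \<or> a = 0"
proof
  assume *: "int_times s a = 0"
  show "s = 0 \<or> a = 0"
  proof (cases "s = 0")
    case False
    have "coord a k = coord 0 k" for k
      using arg_cong[OF *, of "\<lambda>x. coord x k"] False by simp
    then show ?thesis using coord_eqI by blast
  qed simp
qed (auto intro!: coord_eqI)

lemma int_times_nat: "int_times (int m) a = nat_times m a"
  by (rule coord_eqI) simp

lemma nat_times_diff: "nat_times m (a - b) = nat_times m a - nat_times m b"
  for a b :: 'a
  by (rule coord_eqI) (simp add: algebra_simps)

lemma int_times_add: "int_times s (a + b) = int_times s a + int_times s b"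
  by (rule coord_eqI) (simp add: algebra_simps)

lemma int_times_diff: "int_times s (a - b) = int_times s a - int_times s b"
  by (rule coord_eqI) (simp add: algebra_simps)

lemma int_times_add_left: "int_times (s + t) a = int_times s a + int_times t a"
  by (rule coord_eqI) (simp add: algebra_simps)

lemma int_times_mult: "int_times (s * t) a = int_times s (int_times t a)"
  by (rule coord_eqI) (simp add: algebra_simps)

lemma int_times_0_left [simp]: "int_times 0 a = 0"
  and int_times_0_right [simp]: "int_times s 0 = 0"
  and int_times_1 [simp]: "int_times 1 a = a"
  and int_times_minus: "int_times (- s) a = - int_times s a"
  by (rule coord_eqI, simp)+

lemma int_times_cancel: "s \<noteq> 0 \<Longrightarrow> int_times s a = int_times s b \<longleftrightarrow> a = b"
  using int_times_eq_0[of s "a - b"] by (auto simp: int_times_diff)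

lemma inj_nat_times: "m \<noteq> 0 \<Longrightarrow> inj (nat_times m :: 'a \<Rightarrow> 'a)"
  by (rule injI) (metis int_times_cancel int_times_nat of_nat_eq_0_iff)

section \<open>Orbits, the trace and the fixed vectors\<close>

lemma g_0 [simp]: "g 0 = 0"
  using g_add[of 0 0] by simp

lemma g_uminus: "g (- a) = - g a"
  using g_add[of a "- a"] by (simp add: eq_neg_iff_add_eq_0 add.commute)

lemma g_diff: "g (a - b) = g a - g b"
  using g_add[of a "- b"] by (simp add: g_uminus)

lemma g_nat_times: "g (nat_times m a) = nat_times m (g a)"
  by (induction m) (simp_all add: g_add)

lemma g_int_times: "g (int_times s a) = int_times s (g a)"
proof (cases "s \<ge> 0")
  case True
  then show ?thesis using g_nat_times[of "nat s" a] by (simp flip: int_times_nat)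
next
  case False
  then have "int_times s x = - nat_times (nat (- s)) x" for x
    using int_times_minus[of "- s" x] int_times_nat[of "nat (- s)" x] by simp
  then show ?thesis using g_nat_times[of "nat (- s)" a] by (simp add: g_uminus)
qed

lemma g_pow_add: "(g ^^ i) (a + b) = (g ^^ i) a + (g ^^ i) b"
  by (induction i) (simp_all add: g_add)

lemma g_pow_0 [simp]: "(g ^^ i) 0 = 0"
  by (induction i) simp_all

lemma g_pow_diff: "(g ^^ i) (a - b) = (g ^^ i) a - (g ^^ i) b"
  by (induction i) (simp_all add: g_diff)

lemma g_pow_nat_times: "(g ^^ i) (nat_times m a) = nat_times m ((g ^^ i) a)"
  by (induction i) (simp_all add: g_nat_times)

lemma g_pow_fixed: "g u = u \<Longrightarrow> (g ^^ i) u = u"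
  by (induction i) simp_all

lemma g_pow_commute: "g ((g ^^ i) a) = (g ^^ i) (g a)"
  by (simp add: funpow_swap1)

lemma p_gt_2: "p > 2"
  using prime_p odd_p prime_ge_2_nat[of p] by (metis dvd_refl le_neq_implies_less)

lemma p_pos: "p > 0"
  using p_gt_2 by simp

lemma g_pow_mult_p: "(g ^^ (k * p)) a = a"
  by (induction k) (simp_all add: funpow_add g_p)

text \<open>As \<open>i\<close> is invertible modulo the prime p, some power of
  \<open>g ^^ i\<close> equals \<open>g\<close>, so a vector fixed by \<open>g ^^ i\<close> is fixed
  by \<open>g\<close>.\<close>

lemma g_pow_regular:
  assumes "g a \<noteq> a" "0 < i" "i < p"
  shows "(g ^^ i) a \<noteq> a"
proof
  assume *: "(g ^^ i) a = a"
  have "coprime i p"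
    using prime_p assms(2,3) by (metis coprime_commute nat_dvd_not_less prime_imp_coprime)
  then obtain x y where xy: "i * x - p * y = 1" "p * y \<le> i * x"
    using coprime_bezout_strong[of i p] p_gt_2 by (metis bezout_nat assms(2) coprime_iff_gcd_eq_1 
        add_diff_cancel_left' le_add1 less_numeral_extra(3))
  have "(g ^^ (i * x)) a = a"
    by (induction x) (simp_all add: funpow_add *)
  moreover have "i * x = Suc (y * p)" using xy by (simp add: mult.commute)
  ultimately have "g ((g ^^ (y * p)) a) = a" by simp
  then show False using assms(1) by (simp add: g_pow_mult_p)
qed

lemma inj_on_g_pow:
  assumes "g a \<noteq> a"
  shows "inj_on (\<lambda>i. (g ^^ i) a) {..<p}"
proof (rule linorder_inj_onI)
  fix i j assume ij: "i < j" "i \<in> {..<p}" "j \<in> {..<p}"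
  show "(g ^^ i) a \<noteq> (g ^^ j) a"
  proof
    assume "(g ^^ i) a = (g ^^ j) a"
    then have "(g ^^ (p - i)) ((g ^^ i) a) = (g ^^ (p - i)) ((g ^^ j) a)" by simp
    then have "(g ^^ (p - i + i)) a = (g ^^ (p - i + j)) a" by (simp add: funpow_add)
    moreover have "p - i + i = p" "p - i + j = (j - i) + p" using ij by auto
    ultimately have "a = (g ^^ (j - i)) a" by (simp only: funpow_add comp_apply g_p)
    then show False using g_pow_regular[OF assms, of "j - i"] ij
      by (metis lessThan_iff less_imp_diff_less zero_less_diff)
  qed
qed auto

definition trace :: "'a \<Rightarrow> 'a"
  where "trace a = (\<Sum>i<p. (g ^^ i) a)"

lemma sum_shift: "(\<Sum>i<p. h ((g ^^ i) (g a))) = (\<Sum>i<p. h ((g ^^ i) a))"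
  for h :: "'a \<Rightarrow> 'b::comm_monoid_add"
proof -
  have "(\<Sum>i<p. h ((g ^^ i) (g a))) = (\<Sum>i<p. h ((g ^^ Suc i) a))"
    by (simp add: funpow_swap1)
  moreover have "h a + (\<Sum>i<p. h ((g ^^ Suc i) a)) = (\<Sum>i<p. h ((g ^^ i) a)) + h ((g ^^ p) a)"
    using sum.lessThan_Suc_shift[of "\<lambda>i. h ((g ^^ i) a)" p]
      sum.lessThan_Suc[of "\<lambda>i. h ((g ^^ i) a)" p] by simp
  moreover obtain q where q: "p = Suc q" using p_pos by (cases p) auto
  have "(\<Sum>i<p. h ((g ^^ Suc i) a)) = (\<Sum>i<q. h ((g ^^ Suc i) a)) + h ((g ^^ p) a)"
    unfolding q by simp
  moreover have "(\<Sum>i<p. h ((g ^^ i) a)) = h a + (\<Sum>i<q. h ((g ^^ Suc i) a))"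
    unfolding q by (subst sum.lessThan_Suc_shift) simp
  ultimately show ?thesis by (simp add: g_p add.commute)
qed

lemma trace_g: "trace (g a) = trace a"
  unfolding trace_def by (rule sum_shift[of "\<lambda>x. x"])

lemma trace_g_pow: "trace ((g ^^ i) a) = trace a"
  by (induction i) (simp_all add: trace_g)

lemma g_sum: "g (sum h X) = (\<Sum>x\<in>X. g (h x))"
  by (induction X rule: infinite_finite_induct) (simp_all add: g_add)

lemma g_trace: "g (trace a) = trace a"
  using trace_g[of a] unfolding trace_def g_sum by (simp add: g_pow_commute)

lemma trace_add: "trace (a + b) = trace a + trace b"
  by (simp add: trace_def g_pow_add sum.distrib)

lemma trace_diff: "trace (a - b) = trace a - trace b"
  by (simp add: trace_def g_pow_diff sum_subtractf)

lemma trace_nat_times: "trace (nat_times m a) = nat_times m (trace a)"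
  by (induction m) (simp_all add: trace_add, simp add: trace_def)

lemma trace_fixed: "g u = u \<Longrightarrow> trace u = nat_times p u"
  by (simp add: trace_def g_pow_fixed nat_times_def)

text \<open>The trace is always fixed, and since A has no torsion, \<open>a\<close> is fixed as soon
  as p a is. Fixedness thus becomes the vanishing of an additive map, whose coordinates later give
  derivations.\<close>

lemma g_fixed_iff: "g a = a \<longleftrightarrow> nat_times p a = trace a"
proof
  assume *: "nat_times p a = trace a"
  have "nat_times p (g a) = g (nat_times p a)" by (simp only: g_nat_times)
  also have "\<dots> = nat_times p a" by (simp only: * g_trace)
  finally have "nat_times p (g a) = nat_times p a" .
  then show "g a = a" using injD[OF inj_nat_times[of p]] p_pos by simp
qed (simp add: trace_fixed)

text \<open>A difference of conjugates has trace 0, and a fixed vector of trace 0 is annihilated by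
  p, hence 0.\<close>

lemma regular_difference_moves:
  assumes "g a \<noteq> a" "0 < i" "i < p"
  shows "g ((g ^^ i) a - a) \<noteq> (g ^^ i) a - a"
proof
  let ?y = "(g ^^ i) a - a"
  assume "g ?y = ?y"
  then have "nat_times p ?y = trace ?y" by (simp only: g_fixed_iff)
  then have "nat_times p ?y = nat_times p 0"
    by (simp add: trace_diff trace_g_pow) (simp add: nat_times_def)
  then have "?y = 0" using injD[OF inj_nat_times[of p]] p_pos by blast
  then show False using g_pow_regular[OF assms] by simp
qed

text \<open>A size that is multiplied by m together with the vector; it makes repeated division by
  p, and later by the characteristic, terminate.\<close>

definition norm1 :: "'a \<Rightarrow> nat"
  where "norm1 a = (\<Sum>k<n. nat \<bar>coord a k\<bar>)"

lemma norm1_nat_times: "norm1 (nat_times m a) = m * norm1 a"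
  by (simp add: norm1_def abs_mult nat_mult_distrib sum_distrib_left)

lemma coord_outside: "k \<ge> n \<Longrightarrow> coord a k = 0"
  using range_\<iota> by (metis (mono_tags, lifting) in_keys_iff lessThan_iff linorder_not_le
      mem_Collect_eq rangeI subsetD)

lemma norm1_eq_0: "norm1 a = 0 \<longleftrightarrow> a = 0"
proof
  assume "norm1 a = 0"
  then have "coord a k = coord 0 k" for k
    using coord_outside[of k a] by (cases "k < n") (auto simp: norm1_def)
  then show "a = 0" using coord_eqI by blast
qed (simp add: norm1_def)

text \<open>\<open>A / T\<close> is the quotient of the coinvariants \<open>A\<^sub>G\<close> by the image of \<open>A\<^sup>G\<close>, with \<open>g\<close> generating \<open>G\<close>.\<close>

definition T :: "'a set"
  where "T = {u + (g b - b) |u b. g u = u}"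

lemma T_fixed: "g u = u \<Longrightarrow> u \<in> T"
  unfolding T_def by (rule CollectI, rule exI[of _ u], rule exI[of _ 0]) simp

lemma T_diff_g: "g b - b \<in> T"
  unfolding T_def by (rule CollectI, rule exI[of _ 0], rule exI[of _ b]) simp

lemma T_add: "x \<in> T \<Longrightarrow> y \<in> T \<Longrightarrow> x + y \<in> T"
proof -
  assume "x \<in> T" "y \<in> T"
  then obtain u b v c where "x = u + (g b - b)" "g u = u" "y = v + (g c - c)" "g v = v"
    unfolding T_def by blast
  then have "x + y = (u + v) + (g (b + c) - (b + c))" "g (u + v) = u + v"
    by (simp_all add: g_add)
  then show ?thesis unfolding T_def by blast
qed

lemma T_minus: "x \<in> T \<Longrightarrow> - x \<in> T"
proof -
  assume "x \<in> T"
  then obtain u b where "x = u + (g b - b)" "g u = u"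
    unfolding T_def by blast
  then have "- x = (- u) + (g (- b) - (- b))" "g (- u) = - u"
    by (simp_all add: g_uminus)
  then show ?thesis unfolding T_def by blast
qed

lemma T_diff: "x \<in> T \<Longrightarrow> y \<in> T \<Longrightarrow> x - y \<in> T"
  using T_add[of x "- y"] T_minus[of y] by simp

lemma T_g_pow: "(g ^^ i) b - b \<in> T"
proof (induction i)
  case (Suc i)
  have "(g ^^ Suc i) b - b = (g ((g ^^ i) b) - (g ^^ i) b) + ((g ^^ i) b - b)" by simp
  then show ?case using T_add[OF T_diff_g Suc.IH] by metis
qed (simp add: T_fixed)

section \<open>A as a module over Z[t], with t acting as g\<close>

definition act :: "int poly \<Rightarrow> 'a \<Rightarrow> 'a"
  where "act P z = fold_coeffs (\<lambda>s x. int_times s z + g x) P 0"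

lemma act_0 [simp]: "act 0 z = 0"
  by (simp add: act_def)

lemma act_pCons [simp]: "act (pCons s P) z = int_times s z + g (act P z)"
  by (cases "P = 0 \<and> s = 0") (auto simp: act_def)

lemma act_add: "act (P + Q) z = act P z + act Q z"
  by (induction P Q rule: poly_induct2) (simp_all add: int_times_add_left g_add)

lemma act_smult: "act (smult s P) z = int_times s (act P z)"
  by (induction P) (simp_all add: int_times_mult int_times_add g_int_times)

lemma act_monom: "act (monom 1 i) z = (g ^^ i) z"
  by (induction i) (simp_all add: monom_Suc monom_0)

lemma act_1 [simp]: "act 1 z = z"
  by (simp add: one_pCons)

lemma act_difference_power: "act ([:-1, 1:] ^ m) z = ((\<lambda>x. g x - x) ^^ m) z"
proof (induction m)
  case (Suc m)
  have "[:-1, 1:] ^ Suc m = pCons 0 ([:-1, 1:] ^ m) + smult (- 1) ([:-1, 1 :: int:] ^ m)"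
    by simp
  then show ?case
    using Suc.IH by (simp only: act_add act_smult act_pCons) (simp add: int_times_minus)
qed simp

lemma act_in_difference_range: "z \<in> range (\<lambda>x. g x - x) \<Longrightarrow> act P z \<in> range (\<lambda>x. g x - x)"
proof (induction P)
  case 0
  show ?case by (rule image_eqI[of _ _ 0]) simp_all
next
  case (pCons s P)
  then obtain x y where "act P z = g x - x" "z = g y - y" by blast
  then have "act (pCons s P) z = g (int_times s y + g x) - (int_times s y + g x)"
    by (simp add: g_add g_int_times int_times_diff g_diff)
  then show ?case by blast
qed

text \<open>Modulo p one has (t - 1)^p = t^p - 1, and t^p - 1 acts as 0 because the p-th power of g
  is the identity. \<open>Q\<close> is the difference of the two polynomials divided by p; oddness
  of p gives the sign of the constant term.\<close>

lemma difference_power_p: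
  "\<exists>Q. \<forall>z. ((\<lambda>x. g x - x) ^^ p) z = nat_times p (act Q z)"
proof -
  let ?P = "[:-1, 1:] ^ p - (monom 1 p + smult (- 1) (1 :: int poly))"
  have "int p dvd coeff ?P k" for k
  proof -
    have "[:-1, 1 :: int:] = monom 1 1 + [:- 1:]" by (simp add: monom_altdef)
    then have "coeff ([:-1, 1 :: int:] ^ p) k =
        coeff (\<Sum>i\<le>p. of_nat (p choose i) * monom 1 1 ^ i * [:- 1:] ^ (p - i)) k"
      by (simp only: binomial_ring)
    also have "\<dots> = (\<Sum>i\<le>p. if i = k then int (p choose i) * (- 1) ^ (p - i) else 0)"
      unfolding coeff_sum
    proof (rule sum.cong)
      fix i
      have "of_nat (p choose i) * monom 1 1 ^ i * [:- 1:] ^ (p - i)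
          = monom (int (p choose i) * (- 1) ^ (p - i)) i"
        by (simp add: monom_power of_nat_poly smult_monom poly_const_pow mult.commute)
      then show "coeff (of_nat (p choose i) * monom 1 1 ^ i * [:- 1:] ^ (p - i)) k
          = (if i = k then int (p choose i) * (- 1) ^ (p - i) else 0)"
        by simp
    qed simp
    also have "\<dots> = (if k \<le> p then int (p choose k) * (- 1) ^ (p - k) else 0)"
      by simp
    finally have c: "coeff ([:-1, 1 :: int:] ^ p) k = \<dots>" .
    consider "k = 0" | "k = p" | "k > p" | "0 < k" "k < p" by linarith
    then show ?thesis
    proof cases
      case 4
      then have "p dvd p choose k"
        using prime_p by (intro dvd_choose_prime) auto
      then show ?thesis using 4 c by (simp add: coeff_pCons split: nat.splits)
    qed (use p_pos odd_p c in \<open>auto simp: coeff_1 coeff_pCons split: nat.splits\<close>)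
  qed
  then have "[:int p:] dvd ?P" by (simp add: const_poly_dvd_iff)
  then obtain Q where "?P = [:int p:] * Q" by (rule dvdE)
  then have Q: "[:-1, 1:] ^ p = (monom 1 p + smult (- 1) (1 :: int poly)) + smult (int p) Q"
    by (simp add: algebra_simps)
  have "((\<lambda>x. g x - x) ^^ p) z = nat_times p (act Q z)" for z
    unfolding act_difference_power[symmetric] Q
    by (simp add: act_add act_smult act_monom g_p int_times_nat one_pCons int_times_minus)
  then show ?thesis by blast
qed

text \<open>
  If \<open>T = A\<close> then \<open>g - 1\<close> maps its image \<open>C\<close> onto itself; as \<open>(g - 1)\<^sup>p\<close> is divisible by \<open>p\<close>,
  this gives \<open>C = p C\<close>, hence \<open>C = 0\<close>.
\<close>

lemma T_proper: "\<exists>a. a \<notin> T"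
proof (rule ccontr)
  assume "\<nexists>a. a \<notin> T"
  then have T: "a \<in> T" for a by blast
  let ?d = "\<lambda>x. g x - x"
  have iter: "\<exists>x. ?d a = (?d ^^ Suc m) x" for a m
  proof (induction m arbitrary: a)
    case (Suc m)
    obtain u b where "a = u + ?d b" "g u = u" using T[of a] unfolding T_def by blast
    then have "?d a = ?d (?d b)" by (simp add: g_add g_diff)
    moreover obtain x where "?d b = (?d ^^ Suc m) x" using Suc.IH by blast
    ultimately show ?case by (metis comp_apply funpow.simps(2))
  qed auto
  obtain Q where Q: "(?d ^^ p) z = nat_times p (act Q z)" for z
    using difference_power_p by blast
  have "y = 0" if "y \<in> range ?d" for y
    using that
  proof (induction "norm1 y" arbitrary: y rule: less_induct)
    case less
    \<comment> \<open>One application more than p, so that the vector left after division by p lies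
      again in the image of \<open>?d\<close> and the induction hypothesis applies to it.\<close>
    then obtain x where "y = (?d ^^ Suc p) x" using iter[of _ p] by blast
    then have y: "y = nat_times p (act Q (?d x))"
      using Q[of "?d x"] by (simp only: funpow_Suc_right comp_apply)
    have C: "act Q (?d x) \<in> range ?d" by (rule act_in_difference_range) blast
    show "y = 0"
    proof (cases "norm1 (act Q (?d x)) < norm1 y")
      case True
      then show ?thesis using less.hyps[OF True C] y by (simp add: nat_times_def)
    next
      case False
      then have "norm1 y = 0"
        using arg_cong[OF y, of norm1] p_gt_2 by (simp add: norm1_nat_times)
      then show ?thesis by (simp add: norm1_eq_0)
    qed
  qed
  then have "g x = x" for x by (metis rangeI right_minus_eq)
  then show False using g_nontrivial by blast
qed

section \<open>Independent orbit differences\<close>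

definition non_parallel :: "'a \<Rightarrow> 'a \<Rightarrow> bool"
  where "non_parallel x y \<longleftrightarrow> (\<forall>s t. int_times s x = int_times t y \<longrightarrow> s = 0 \<and> t = 0)"

text \<open>An eigenvalue of \<open>g\<close> on a rational line would be a rational \<open>p\<close>-th root of unity, hence 1 as \<open>p\<close> is odd.\<close>

lemma no_eigenvector:
  assumes "g y \<noteq> y" "int_times \<alpha> y + int_times \<beta> (g y) = 0"
  shows "\<alpha> = 0 \<and> \<beta> = 0"
proof -
  have y: "y \<noteq> 0" using assms(1) g_0 by metis
  have step: "int_times \<beta> (g y) = int_times (- \<alpha>) y"
    using assms(2) unfolding int_times_minus by (metis add.commute eq_neg_iff_add_eq_0)
  have "int_times (\<beta> ^ i) ((g ^^ i) y) = int_times ((- \<alpha>) ^ i) y" for i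
  proof (induction i)
    case (Suc i)
    have "int_times (\<beta> ^ Suc i) ((g ^^ Suc i) y) = int_times \<beta> (g (int_times (\<beta> ^ i) ((g ^^ i) y)))"
      by (simp only: int_times_mult g_int_times power_Suc funpow.simps comp_apply)
    also have "\<dots> = int_times ((- \<alpha>) ^ i) (int_times \<beta> (g y))"
      by (simp only: Suc.IH g_int_times mult.commute[of \<beta>] flip: int_times_mult)
    also have "\<dots> = int_times ((- \<alpha>) ^ Suc i) y"
      by (simp only: step power_Suc mult.commute flip: int_times_mult)
    finally show ?case .
  qed simp
  from this[of p] have "int_times (\<beta> ^ p - (- \<alpha>) ^ p) y = 0"
    using int_times_add_left[of "\<beta> ^ p" "- ((- \<alpha>) ^ p)" y] by (simp add: g_p int_times_minus)
  then have "\<beta> ^ p = (- \<alpha>) ^ p" using y by (simp add: int_times_eq_0)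
  then have eq: "\<beta> = - \<alpha>" using odd_p by (rule power_odd_inj)
  then have "int_times \<beta> (g y) = int_times \<beta> y" using step by simp
  then have "\<beta> = 0" using assms(1) int_times_cancel by blast
  then show ?thesis using eq by simp
qed

text \<open>The candidates are a + m g a; their differences are y + m g y with y = g^i a - a. There
  are finitely many index pairs, so if every m failed, two distinct values would fail at the same
  pair. Then y + m g y and y + m' g y would both be rationally proportional to one vector v, and
  eliminating v contradicts the independence of y and g y.\<close>

lemma exists_non_parallel_orbit:
  assumes a: "g a \<noteq> a"
  shows "\<exists>c. g c \<noteq> c \<and> (\<forall>i\<in>{1..<p}. \<forall>j\<in>{1..<p}. non_parallel ((g ^^ i) c - c) ((g ^^ j) a - a))"
proof (rule ccontr)
  assume neg: "\<not> ?thesis"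
  let ?c = "\<lambda>m. a + nat_times m (g a)"
  have diff: "(g ^^ i) (?c m) - ?c m = ((g ^^ i) a - a) + int_times (int m) (g ((g ^^ i) a - a))" for i m
    unfolding int_times_nat by (simp add: g_pow_add g_pow_nat_times g_diff g_pow_commute nat_times_diff)
  have "g (?c m) \<noteq> ?c m" for m
  proof
    assume *: "g (?c m) = ?c m"
    have "(g ^^ 1) (?c m) - ?c m = 0"
      unfolding One_nat_def funpow.simps comp_apply id_apply * by simp
    then have "int_times 1 (g a - a) + int_times (int m) (g (g a - a)) = 0"
      unfolding diff by simp
    moreover have "g (g a - a) \<noteq> g a - a"
      using regular_difference_moves[OF a, of 1] p_gt_2 by simp
    ultimately show False
      using no_eigenvector[of "g a - a" 1 "int m"] by simp
  qed
  then have "\<exists>i\<in>{1..<p}. \<exists>j\<in>{1..<p}. \<not> non_parallel ((g ^^ i) (?c m) - ?c m) ((g ^^ j) a - a)" for m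
    using neg by blast
  then obtain I J where IJ: "I m \<in> {1..<p}" "J m \<in> {1..<p}"
    "\<not> non_parallel ((g ^^ I m) (?c m) - ?c m) ((g ^^ J m) a - a)" for m
    by metis
  have "finite ((\<lambda>m. (I m, J m)) ` UNIV)"
    by (rule finite_subset[of _ "{1..<p} \<times> {1..<p}"]) (use IJ in auto)
  then have "\<not> inj (\<lambda>m. (I m, J m))"
    using finite_imageD by blast
  then obtain m m' where m: "m \<noteq> m'" "I m = I m'" "J m = J m'"
    unfolding inj_def by auto
  define y where "y = (g ^^ I m) a - a"
  define v where "v = (g ^^ J m) a - a"
  have gy: "g y \<noteq> y" and v0: "v \<noteq> 0"
    using regular_difference_moves[OF a, of "I m"] g_pow_regular[OF a, of "J m"] IJ(1,2)[of m]
    by (auto simp: y_def v_def)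
  have rel: "\<exists>s t. s \<noteq> 0 \<and> int_times s y + int_times (s * int x) (g y) = int_times t v"
    if eq: "I x = I m" "J x = J m" for x
  proof -
    obtain s t where st: "int_times s (y + int_times (int x) (g y)) = int_times t v" "s \<noteq> 0 \<or> t \<noteq> 0"
      using IJ(3)[of x] unfolding non_parallel_def diff eq y_def[symmetric] v_def[symmetric] by blast
    then have "s \<noteq> 0" using v0 int_times_eq_0[of t v] by auto
    then show ?thesis using st(1) by (auto simp: int_times_add int_times_mult)
  qed
  obtain s t where st: "s \<noteq> 0" "int_times s y + int_times (s * int m) (g y) = int_times t v"
    using rel[of m] by auto
  obtain s' t' where st': "s' \<noteq> 0" "int_times s' y + int_times (s' * int m') (g y) = int_times t' v"
    using rel[of m'] m by auto
  have "int_times (t' * s - t * s') y + int_times (t' * s * int m - t * s' * int m') (g y) = 0"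
  proof (rule coord_eqI)
    fix k
    have 1: "s * coord y k + s * int m * coord (g y) k = t * coord v k"
      using arg_cong[OF st(2), of "\<lambda>x. coord x k"] by simp
    have 2: "s' * coord y k + s' * int m' * coord (g y) k = t' * coord v k"
      using arg_cong[OF st'(2), of "\<lambda>x. coord x k"] by simp
    have "(t' * s - t * s') * coord y k + (t' * s * int m - t * s' * int m') * coord (g y) k
        = t' * (s * coord y k + s * int m * coord (g y) k) - t * (s' * coord y k + s' * int m' * coord (g y) k)"
      by (simp add: algebra_simps)
    also have "\<dots> = 0" unfolding 1 2 by simp
    finally show "coord (int_times (t' * s - t * s') y + int_times (t' * s * int m - t * s' * int m') (g y)) k
        = coord 0 k" by simp
  qed
  from no_eigenvector[OF gy this]
  have *: "t' * s = t * s'" "t' * s * int m = t * s' * int m'" by auto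
  then have "t * s' * (int m - int m') = 0" by (simp add: algebra_simps)
  \<comment> \<open>With \<open>t = 0\<close> the relation for \<open>m\<close> no longer involves
    \<open>v\<close>, and \<open>no_eigenvector\<close> applies to it directly.\<close>
  then have "t = 0" using m(1) st'(1) by simp
  then have "s = 0" using no_eigenvector[OF gy, of s "s * int m"] st(2) by simp
  then show False using st(1) by simp
qed

subsection \<open>Coprime binomials\<close>

text \<open>Moving an exponent by a multiple of u changes a monomial by a multiple of 1 - e^u, by
  telescoping; so \<open>y\<close> is congruent to its image, which is 0. When \<rho> picks coset
  representatives, this says that the kernel of k[A] -> k[A / Zu] lies in the ideal of 1 -
  e^u.\<close>

lemma dvd_of_linear_extension_0:
  assumes \<rho>: "\<And>a. \<exists>s. \<rho> a = a + int_times s u"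
    and 0: "linear_extension \<rho> y = 0"
  shows "(1 - Poly_Mapping.single u 1) dvd (y :: 'a \<Rightarrow>\<^sub>0 'k::field)"
proof -
  let ?b = "1 - Poly_Mapping.single u (1::'k)"
  have nat: "?b dvd Poly_Mapping.single a c - Poly_Mapping.single (a + int_times (int m) u) c" for a c m
  proof (induction m)
    case (Suc m)
    have "Poly_Mapping.single a c - Poly_Mapping.single (a + int_times (int (Suc m)) u) c
        = (Poly_Mapping.single a c - Poly_Mapping.single (a + int_times (int m) u) c)
          + Poly_Mapping.single (a + int_times (int m) u) c * ?b"
      unfolding int_times_nat by (simp add: right_diff_distrib mult_single add.assoc)
    then show ?case using Suc.IH by (metis dvd_add dvd_triv_right)
  qed simp
  have int: "?b dvd Poly_Mapping.single a c - Poly_Mapping.single (a + int_times s u) c" for a c s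
  proof (cases "s \<ge> 0")
    case True
    then show ?thesis using nat[where m = "nat s"] by simp
  next
    case False
    have "int_times (int (nat (- s))) u = - int_times s u"
      using False int_times_minus[of s u] by simp
    then have "a + int_times s u + int_times (int (nat (- s))) u = a" by simp
    then show ?thesis
      using nat[of "a + int_times s u" c "nat (- s)"] by (metis dvd_minus_iff minus_diff_eq)
  qed
  have "y = (\<Sum>a\<in>Poly_Mapping.keys y. Poly_Mapping.single a (Poly_Mapping.lookup y a)) -
      linear_extension \<rho> y"
    by (simp add: 0 poly_mapping_sum_single)
  also have "\<dots> = (\<Sum>a\<in>Poly_Mapping.keys y. Poly_Mapping.single a (Poly_Mapping.lookup y a) -
      Poly_Mapping.single (\<rho> a) (Poly_Mapping.lookup y a))"
    by (simp add: linear_extension_def sum_subtractf)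
  finally show ?thesis
    using int \<rho> by (metis (no_types, lifting) dvd_sum)
qed

lemma keys_linear_extension: "Poly_Mapping.keys (linear_extension f y) \<subseteq> f ` Poly_Mapping.keys y"
  unfolding linear_extension_def
  by (rule order_trans[OF keys_sum]) (auto split: if_splits)

text \<open>In k[A / Zu] the hypothesis says that the image of \<open>y\<close> is invariant under
  translation by v. As v has infinite order in A / Zu, an invariant element of finite support is 0,
  so \<open>y\<close> lies in the kernel.\<close>

lemma binomials_coprime:
  fixes y :: "'a \<Rightarrow>\<^sub>0 'k::field"
  assumes ind: "non_parallel u v"
    and dvd: "(1 - Poly_Mapping.single u 1) dvd (1 - Poly_Mapping.single v 1) * y"
  shows "(1 - Poly_Mapping.single u 1) dvd y"
proof -
  define rel where "rel a b \<longleftrightarrow> (\<exists>s. b = a + int_times s u)" for a b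
  have rel_refl: "rel a a" for a
    unfolding rel_def by (rule exI[of _ 0]) simp
  have rel_sym: "rel b a" if "rel a b" for a b
    using that unfolding rel_def by (metis add_diff_cancel_right' diff_conv_add_uminus int_times_minus)
  have rel_trans: "rel a c" if "rel a b" "rel b c" for a b c
    using that unfolding rel_def by (metis add.assoc int_times_add_left)
  have rel_add: "rel (a + x) (b + x)" if "rel a b" for a b x
    using that unfolding rel_def by (metis add.assoc add.commute)
  \<comment> \<open>Coset representatives replace the quotient: \<open>\<rho>\<close> stands for the
    projection onto A / Zu, and \<open>\<sigma>\<close> for translation by v there.\<close>
  define \<rho> where "\<rho> a = (SOME b. rel a b)" for a
  have \<rho>: "rel a (\<rho> a)" for a
    unfolding \<rho>_def by (rule someI[of _ a]) (rule rel_refl)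
  have \<rho>_eq: "\<rho> a = \<rho> b" if "rel a b" for a b
  proof -
    have "rel a = rel b" using that rel_sym rel_trans by (intro ext) blast
    then show ?thesis by (simp add: \<rho>_def)
  qed
  define \<sigma> where "\<sigma> b = \<rho> (b + v)" for b
  have \<sigma>: "\<sigma> (\<rho> a) = \<rho> (a + v)" for a
    unfolding \<sigma>_def by (rule \<rho>_eq[symmetric]) (intro rel_add \<rho>)
  let ?\<kappa> = "linear_extension \<rho> :: ('a \<Rightarrow>\<^sub>0 'k) \<Rightarrow> _"
  have kill: "?\<kappa> ((1 - Poly_Mapping.single u 1) * z) = 0" for z
  proof (induction z rule: poly_mapping_single_induct)
    case (single a c)
    have "\<rho> (u + a) = \<rho> a"
      by (rule \<rho>_eq) (auto simp: rel_def int_times_minus intro!: exI[of _ "- 1"])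
    moreover have "(1 - Poly_Mapping.single u 1) * Poly_Mapping.single a c =
        Poly_Mapping.single a c + Poly_Mapping.single (u + a) (- c)"
      by (simp add: left_diff_distrib mult_single single_uminus)
    ultimately show ?case
      by (simp only: linear_extension_add linear_extension_single) (simp flip: single_add)
  qed (simp add: distrib_left linear_extension_add)
  have shift: "?\<kappa> (Poly_Mapping.single v 1 * z) = linear_extension \<sigma> (?\<kappa> z)" for z
    by (induction z rule: poly_mapping_single_induct)
      (simp_all add: mult_single distrib_left linear_extension_add \<sigma> add.commute)
  have "?\<kappa> ((1 - Poly_Mapping.single v 1) * y) = 0"
    using dvd kill by (auto elim: dvdE)
  moreover have "y = (1 - Poly_Mapping.single v 1) * y + Poly_Mapping.single v 1 * y"
    by (simp add: algebra_simps)
  ultimately have fixed: "?\<kappa> y = linear_extension \<sigma> (?\<kappa> y)"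
    by (metis add.left_neutral linear_extension_add shift)
  have fix_pow: "?\<kappa> y = linear_extension (\<sigma> ^^ m) (?\<kappa> y)" for m
  proof (induction m)
    case (Suc m)
    have "?\<kappa> y = linear_extension \<sigma> (?\<kappa> y)" by (fact fixed)
    also have "\<dots> = linear_extension \<sigma> (linear_extension (\<sigma> ^^ m) (?\<kappa> y))"
      using Suc.IH by (rule arg_cong)
    also have "\<dots> = linear_extension (\<sigma> \<circ> \<sigma> ^^ m) (?\<kappa> y)"
      by (rule linear_extension_comp)
    finally show ?case unfolding funpow.simps .
  qed (simp only: funpow.simps linear_extension_id)
  have \<sigma>_pow: "rel (b + int_times (int m) v) ((\<sigma> ^^ m) b)" for b m
  proof (induction m)
    case (Suc m)
    have "rel (b + int_times (int m) v + v) ((\<sigma> ^^ m) b + v)" using Suc.IH by (rule rel_add)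
    then have "rel (b + int_times (int m) v + v) (\<sigma> ((\<sigma> ^^ m) b))"
      unfolding \<sigma>_def[of "(\<sigma> ^^ m) b"] using \<rho> by (rule rel_trans)
    then show ?case unfolding int_times_nat by (simp add: add.assoc)
  qed (simp add: rel_refl)
  have "?\<kappa> y = 0"
  proof (rule ccontr)
    assume "?\<kappa> y \<noteq> 0"
    then obtain b where b: "b \<in> Poly_Mapping.keys (?\<kappa> y)"
      by (metis all_not_in_conv in_keys_iff lookup_zero poly_mapping_eqI)
    \<comment> \<open>Tracing \<open>b\<close> back through m translations gives an exponent of the
      finite support for every m; a repetition relates u and v.\<close>
    have "\<exists>b'\<in>Poly_Mapping.keys (?\<kappa> y). b = (\<sigma> ^^ m) b'" for m
      using keys_linear_extension[of "\<sigma> ^^ m" "?\<kappa> y"] b unfolding fix_pow[of m, symmetric] by blast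
    then obtain h where h: "h m \<in> Poly_Mapping.keys (?\<kappa> y)" "b = (\<sigma> ^^ m) (h m)" for m
      by metis
    have "finite (range h)" by (rule finite_subset[of _ "Poly_Mapping.keys (?\<kappa> y)"]) (use h in auto)
    then have "\<not> inj h" using finite_imageD by blast
    then obtain m m' where m: "m \<noteq> m'" "h m = h m'" unfolding inj_def by blast
    have "rel (h m + int_times (int m) v) (h m + int_times (int m') v)"
      using \<sigma>_pow[of "h m" m] \<sigma>_pow[of "h m'" m'] h(2)[of m] h(2)[of m'] m(2) rel_sym rel_trans by metis
    then obtain s where "int_times (int m') v = int_times (int m) v + int_times s u"
      unfolding rel_def by (auto simp: add.assoc)
    then have "int_times s u = int_times (int m') v - int_times (int m) v" by simp
    then have "int_times s u = int_times (int m' - int m) v"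
      using int_times_add_left[of "int m'" "- int m" v] by (simp add: int_times_minus)
    then show False using ind m(1) unfolding non_parallel_def by force
  qed
  moreover have "\<exists>s. \<rho> a = a + int_times s u" for a using \<rho> unfolding rel_def .
  ultimately show ?thesis by (rule dvd_of_linear_extension_0[rotated])
qed

end

subsection \<open>Derivations of the ring of invariants\<close>

text \<open>Coprimality of x and y is expressed as: x | y z implies x | z for all z. This passes to
  products with no factorisation theory: each factor is split off \<open>z\<close> and cancelled
  before the next one is treated.\<close>

lemma dvd_mult_cancel_prod:
  fixes x :: "'i \<Rightarrow> 'r::comm_ring_1"
  assumes cancel: "\<And>i a b. i \<in> A \<Longrightarrow> x i * a = x i * b \<Longrightarrow> a = b"
    and coprime: "\<And>i z. i \<in> A \<Longrightarrow> x i dvd y * z \<Longrightarrow> x i dvd z"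
    and dvd: "(\<Prod>i\<in>A. x i) dvd y * z"
  shows "(\<Prod>i\<in>A. x i) dvd z"
  using cancel coprime dvd
proof (induction A arbitrary: z rule: infinite_finite_induct)
  case (insert i A)
  have "x i dvd y * z"
    using insert.prems(3) insert.hyps by (simp add: dvd_mult_left)
  then have "x i dvd z" by (rule insert.prems(2)[OF insertI1])
  then obtain z' where z': "z = x i * z'" by (rule dvdE)
  obtain w where "y * z = (\<Prod>i\<in>insert i A. x i) * w"
    using insert.prems(3) by (rule dvdE)
  then have "x i * (y * z') = x i * ((\<Prod>i\<in>A. x i) * w)"
    using insert.hyps by (simp add: z' ac_simps)
  then have "y * z' = (\<Prod>i\<in>A. x i) * w"
    using insert.prems(1)[of i] by blast
  then have "(\<Prod>i\<in>A. x i) dvd y * z'" by simp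
  then have "(\<Prod>i\<in>A. x i) dvd z'"
    by (rule insert.IH[rotated 2]) (blast intro: insert.prems(1), blast intro: insert.prems(2))
  then show ?case using insert.hyps by (simp add: z' mult_dvd_mono)
qed auto

lemma dvd_cancel_coprime_prod:
  fixes y :: "'i \<Rightarrow> 'r::comm_ring_1"
  assumes "\<And>i z. i \<in> A \<Longrightarrow> x dvd y i * z \<Longrightarrow> x dvd z" "x dvd (\<Prod>i\<in>A. y i) * z"
  shows "x dvd z"
  using assms
proof (induction A arbitrary: z rule: infinite_finite_induct)
  case (insert i A)
  have "x dvd y i * ((\<Prod>i\<in>A. y i) * z)"
    using insert.prems(2) insert.hyps by (simp add: ac_simps)
  then have "x dvd (\<Prod>i\<in>A. y i) * z" using insert.prems(1)[of i] by blast
  then show ?case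
    by (rule insert.IH[rotated]) (blast intro: insert.prems(1))
qed auto

locale lattice_invariants = lattice_action \<iota> n g p
  for \<iota> :: "'a::ab_group_add \<Rightarrow> (nat \<Rightarrow>\<^sub>0 int)" and n g p +
  fixes coeff_type :: "'k::field itself"
  assumes p_nonzero: "of_nat p \<noteq> (0::'k)"
begin

abbreviation \<gamma> :: "('a \<Rightarrow>\<^sub>0 'k) \<Rightarrow> ('a \<Rightarrow>\<^sub>0 'k)"
  where "\<gamma> \<equiv> linear_extension g"

abbreviation basis :: "'a \<Rightarrow> ('a \<Rightarrow>\<^sub>0 'k)"
  where "basis a \<equiv> Poly_Mapping.single a 1"

abbreviation const :: "'k \<Rightarrow> ('a \<Rightarrow>\<^sub>0 'k)"
  where "const c \<equiv> Poly_Mapping.single 0 c"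

definition Inv :: "('a \<Rightarrow>\<^sub>0 'k) set"
  where "Inv = {s. \<gamma> s = s}"

lemma \<gamma>_mult: "\<gamma> (s * t) = \<gamma> s * \<gamma> t"
  by (rule linear_extension_mult) (rule g_add)

lemma \<gamma>_1 [simp]: "\<gamma> 1 = 1"
  by (simp flip: single_one)

lemma \<gamma>_pow: "(\<gamma> ^^ i) s = linear_extension (g ^^ i) s"
proof (induction i)
  case (Suc i)
  have "(\<gamma> ^^ Suc i) s = \<gamma> (linear_extension (g ^^ i) s)"
    by (simp add: Suc.IH)
  then show ?case by (simp only: linear_extension_comp funpow.simps)
next
  case 0
  show ?case unfolding funpow.simps linear_extension_id by simp
qed

lemma Inv_add: "r \<in> Inv \<Longrightarrow> s \<in> Inv \<Longrightarrow> r + s \<in> Inv"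
  and Inv_mult: "r \<in> Inv \<Longrightarrow> s \<in> Inv \<Longrightarrow> r * s \<in> Inv"
  and Inv_0: "0 \<in> Inv"
  by (simp_all add: Inv_def linear_extension_add \<gamma>_mult)

lemma Inv_sum: "(\<And>x. x \<in> X \<Longrightarrow> h x \<in> Inv) \<Longrightarrow> sum h X \<in> Inv"
  by (induction X rule: infinite_finite_induct) (auto intro: Inv_0 Inv_add)

lemma Inv_single: "g u = u \<Longrightarrow> Poly_Mapping.single u c \<in> Inv"
  by (simp add: Inv_def)

text \<open>Summed over the p powers of \<open>g\<close> rather than over the set of conjugates; for
  fixed \<open>a\<close> it is p times \<open>basis a\<close>. This keeps the expansion below
  uniform.\<close>

definition orbit_sum :: "'a \<Rightarrow> ('a \<Rightarrow>\<^sub>0 'k)"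
  where "orbit_sum a = (\<Sum>i<p. basis ((g ^^ i) a))"

lemma orbit_sum_Inv: "orbit_sum a \<in> Inv"
proof -
  have "\<gamma> (orbit_sum a) = (\<Sum>i<p. basis ((g ^^ i) (g a)))"
    by (simp add: orbit_sum_def linear_extension_sum g_pow_commute)
  also have "\<dots> = orbit_sum a"
    unfolding orbit_sum_def by (rule sum_shift[of basis])
  finally show ?thesis by (simp add: Inv_def)
qed

text \<open>The Reynolds operator: an invariant is the average of its conjugates, which requires p
  to be invertible in k.\<close>

lemma orbit_sum_expansion:
  assumes "r \<in> Inv"
  shows "r = (\<Sum>a\<in>Poly_Mapping.keys r. const (Poly_Mapping.lookup r a / of_nat p) * orbit_sum a)"
proof -
  have fixed: "linear_extension (g ^^ i) r = r" for i
    unfolding \<gamma>_pow[symmetric] using assms by (induction i) (simp_all add: Inv_def)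
  have "const (of_nat p) * r = (\<Sum>i<p. r)"
    by (simp only: single_of_nat) simp
  also have "\<dots> = (\<Sum>i<p. linear_extension (g ^^ i) r)"
    by (simp only: fixed)
  also have "\<dots> = (\<Sum>a\<in>Poly_Mapping.keys r. \<Sum>i<p. Poly_Mapping.single ((g ^^ i) a) (Poly_Mapping.lookup r a))"
    unfolding linear_extension_def by (rule sum.swap)
  also have "\<dots> = (\<Sum>a\<in>Poly_Mapping.keys r. const (Poly_Mapping.lookup r a) * orbit_sum a)"
    by (simp add: orbit_sum_def sum_distrib_left mult_single)
  finally have "const (inverse (of_nat p)) * (const (of_nat p) * r) =
      (\<Sum>a\<in>Poly_Mapping.keys r. const (Poly_Mapping.lookup r a / of_nat p) * orbit_sum a)"
    by (simp add: sum_distrib_left mult_single field_simps flip: mult.assoc)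
  moreover have "const (inverse (of_nat p)) * const (of_nat p) = 1"
    by (simp only: mult_single add_0 left_inverse[OF p_nonzero] single_one)
  then have "const (inverse (of_nat p)) * (const (of_nat p) * r) = r"
    by (metis mult.assoc mult_1)
  ultimately show ?thesis by simp
qed

section \<open>The group algebra inside a field\<close>

lemma no_zero_divisors: "s * t = 0 \<Longrightarrow> s = 0 \<or> t = 0" for s t :: "'a \<Rightarrow>\<^sub>0 'k"
  using top_exponent_mult(1)[OF \<iota>_add inj_\<iota>] by blast

lemma mult_cancel: "s \<noteq> 0 \<Longrightarrow> s * t = s * t' \<Longrightarrow> t = t'" for s t :: "'a \<Rightarrow>\<^sub>0 'k"
  using no_zero_divisors[of s "t - t'"] by (simp add: right_diff_distrib)

text \<open>Fractions are formed after transport along \<iota>, where the exponents have a type with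
  a linear order, so that the algebra is an integral domain as a type.\<close>

definition frac_embed :: "('a \<Rightarrow>\<^sub>0 'k) \<Rightarrow> ((nat \<Rightarrow>\<^sub>0 int) \<Rightarrow>\<^sub>0 'k) fract"
  where "frac_embed s = to_fract (linear_extension \<iota> s)"

lemma frac_embed_add: "frac_embed (s + t) = frac_embed s + frac_embed t"
  and frac_embed_mult: "frac_embed (s * t) = frac_embed s * frac_embed t"
  and frac_embed_0 [simp]: "frac_embed 0 = 0"
  and frac_embed_1 [simp]: "frac_embed 1 = 1"
  by (simp_all add: frac_embed_def linear_extension_add linear_extension_mult linear_extension_one \<iota>_add)

lemma frac_embed_uminus: "frac_embed (- s) = - frac_embed s"
  using frac_embed_add[of s "- s"] by (simp add: eq_neg_iff_add_eq_0 add.commute)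

lemma frac_embed_diff: "frac_embed (s - t) = frac_embed s - frac_embed t"
  using frac_embed_add[of s "- t"] by (simp add: frac_embed_uminus)

lemma frac_embed_sum: "frac_embed (sum h X) = (\<Sum>x\<in>X. frac_embed (h x))"
  by (induction X rule: infinite_finite_induct) (simp_all add: frac_embed_add)

lemma frac_embed_prod: "frac_embed (prod h X) = (\<Prod>x\<in>X. frac_embed (h x))"
  by (induction X rule: infinite_finite_induct) (simp_all add: frac_embed_mult)

lemma frac_embed_power: "frac_embed (s ^ m) = frac_embed s ^ m"
  by (induction m) (simp_all add: frac_embed_mult)

lemma inj_frac_embed: "inj frac_embed"
  unfolding frac_embed_def using linear_extension_inj[OF inj_\<iota>]
  by (auto intro!: injI dest: injD)

lemma frac_embed_eq_iff [simp]: "frac_embed s = frac_embed t \<longleftrightarrow> s = t"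
  using inj_frac_embed by (auto dest: injD)

definition lift :: "(('a \<Rightarrow>\<^sub>0 'k) \<Rightarrow> ('a \<Rightarrow>\<^sub>0 'k)) \<Rightarrow>
    ((nat \<Rightarrow>\<^sub>0 int) \<Rightarrow>\<^sub>0 'k) fract \<Rightarrow> ((nat \<Rightarrow>\<^sub>0 int) \<Rightarrow>\<^sub>0 'k) fract"
  where "lift f x = frac_embed (f (inv_into UNIV frac_embed x))"

lemma lift_frac_embed [simp]: "lift f (frac_embed s) = frac_embed (f s)"
  by (simp add: lift_def inv_into_f_f[OF inj_frac_embed])

lemma lift_\<gamma>_pow: "(lift \<gamma> ^^ i) (frac_embed s) = frac_embed (linear_extension (g ^^ i) s)"
  unfolding \<gamma>_pow[symmetric] by (induction i) simp_all

sublocale cyc: cyclic_invariants "range frac_embed" "lift \<gamma>" p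
proof
  show "0 \<in> range frac_embed" by (rule range_eqI[of _ _ 0]) simp
  show "1 \<in> range frac_embed" by (rule range_eqI[of _ _ 1]) simp
  show "x + y \<in> range frac_embed" "x * y \<in> range frac_embed" "- x \<in> range frac_embed" "lift \<gamma> x \<in> range frac_embed"
    "lift \<gamma> (x + y) = lift \<gamma> x + lift \<gamma> y" "lift \<gamma> (x * y) = lift \<gamma> x * lift \<gamma> y"
    "(lift \<gamma> ^^ p) x = x"
    if xy: "x \<in> range frac_embed" "y \<in> range frac_embed" for x y
  proof -
    obtain s t where st: "x = frac_embed s" "y = frac_embed t" using xy by blast
    have "g ^^ p = id" using g_p by (intro ext) simp
    then show "x + y \<in> range frac_embed" "x * y \<in> range frac_embed" "- x \<in> range frac_embed" "lift \<gamma> x \<in> range frac_embed"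
      "lift \<gamma> (x + y) = lift \<gamma> x + lift \<gamma> y" "lift \<gamma> (x * y) = lift \<gamma> x * lift \<gamma> y"
      "(lift \<gamma> ^^ p) x = x"
      by (simp_all add: st lift_\<gamma>_pow linear_extension_add \<gamma>_mult
          flip: frac_embed_add frac_embed_mult frac_embed_uminus)
  qed
  show "lift \<gamma> 1 = 1" using lift_frac_embed[of \<gamma> 1] by simp
  show "p > 0" by (rule p_pos)
qed

lemma cyc_R: "cyc.R = frac_embed ` Inv"
  by (auto simp: cyc.R_def Inv_def)

definition orbit_binomials :: "'a \<Rightarrow> ('a \<Rightarrow>\<^sub>0 'k)"
  where "orbit_binomials a = (\<Prod>i\<in>{1..<p}. 1 - basis ((g ^^ i) a - a))"

text \<open>Each factor e^a - e^(g^i a) is the unit e^a times a binomial, so up to units only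
  binomials can occur in denominators.\<close>

lemma different_basis:
  "cyc.different (frac_embed (basis a)) = frac_embed (basis a ^ (p - 1) * orbit_binomials a)"
proof -
  have "cyc.different (frac_embed (basis a)) = frac_embed (\<Prod>i\<in>{1..<p}. basis a - basis ((g ^^ i) a))"
    unfolding cyc.different_def by (simp add: lift_\<gamma>_pow frac_embed_prod frac_embed_diff)
  also have "(\<Prod>i\<in>{1..<p}. basis a - basis ((g ^^ i) a)) =
      (\<Prod>i\<in>{1..<p}. basis a * (1 - basis ((g ^^ i) a - a)))"
    by (simp add: right_diff_distrib mult_single)
  also have "\<dots> = basis a ^ (p - 1) * orbit_binomials a"
    by (simp add: prod.distrib orbit_binomials_def)
  finally show ?thesis .
qed

lemma binomial_nonzero: "u \<noteq> 0 \<Longrightarrow> 1 - basis u \<noteq> 0"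
  by (metis eq_iff_diff_eq_0 inj_single injD lookup_one lookup_single_eq when_simps(2) zero_neq_one)

lemma orbit_binomials_coprime:
  assumes moves: "g a \<noteq> a" and np: "\<And>i j. i \<in> {1..<p} \<Longrightarrow> j \<in> {1..<p} \<Longrightarrow>
      non_parallel ((g ^^ i) a - a) ((g ^^ j) c - c)"
    and dvd: "orbit_binomials a dvd orbit_binomials c * z"
  shows "orbit_binomials a dvd z"
  using _ _ dvd unfolding orbit_binomials_def
proof (rule dvd_mult_cancel_prod)
  fix i w assume i: "i \<in> {1..<p}"
  have "(g ^^ i) a - a \<noteq> 0" using g_pow_regular[OF moves, of i] i by auto
  then show "w = w'" if "(1 - basis ((g ^^ i) a - a)) * w = (1 - basis ((g ^^ i) a - a)) * w'" for w'
    using mult_cancel[OF binomial_nonzero that] by blast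
  assume "(1 - basis ((g ^^ i) a - a)) dvd (\<Prod>j\<in>{1..<p}. 1 - basis ((g ^^ j) c - c)) * w"
  then show "(1 - basis ((g ^^ i) a - a)) dvd w"
  proof (rule dvd_cancel_coprime_prod[rotated])
    fix j z assume "j \<in> {1..<p}" "(1 - basis ((g ^^ i) a - a)) dvd (1 - basis ((g ^^ j) c - c)) * z"
    then show "(1 - basis ((g ^^ i) a - a)) dvd z"
      using binomials_coprime[OF np[OF i]] by blast
  qed
qed

text \<open>Pushing forward along membership in \<open>T\<close> adds up the coefficients on
  \<open>T\<close>. Multiplying by \<open>basis x\<close> beforehand reads off any other coset, so A
  / T is never formed as a type.\<close>

definition coset_sum :: "('a \<Rightarrow>\<^sub>0 'k) \<Rightarrow> 'k"
  where "coset_sum s = Poly_Mapping.lookup (linear_extension (\<lambda>a. a \<in> T) s) True"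

lemma coset_sum_add: "coset_sum (s + t) = coset_sum s + coset_sum t"
  by (simp add: coset_sum_def linear_extension_add lookup_add)

lemma coset_sum_single: "coset_sum (Poly_Mapping.single a c) = (if a \<in> T then c else 0)"
  by (simp add: coset_sum_def lookup_single)

lemma coset_sum_0 [simp]: "coset_sum 0 = 0"
  by (simp add: coset_sum_def)

lemma coset_sum_sum: "coset_sum (sum h X) = (\<Sum>x\<in>X. coset_sum (h x))"
  by (induction X rule: infinite_finite_induct) (simp_all add: coset_sum_add)

lemma coset_sum_const: "coset_sum (const c * s) = c * coset_sum s"
  by (induction s rule: poly_mapping_single_induct)
    (simp_all add: mult_single coset_sum_single coset_sum_add distrib_left)

text \<open>The kernel of \<open>k[A] \<rightarrow> k[A / T]\<close>.\<close>

definition I :: "('a \<Rightarrow>\<^sub>0 'k) set"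
  where "I = {s. \<forall>x. coset_sum (basis x * s) = 0}"

lemma I_add: "s \<in> I \<Longrightarrow> t \<in> I \<Longrightarrow> s + t \<in> I"
  by (simp add: I_def distrib_left coset_sum_add)

lemma I_0: "0 \<in> I"
  by (simp add: I_def)

lemma I_sum: "(\<And>x. x \<in> X \<Longrightarrow> h x \<in> I) \<Longrightarrow> sum h X \<in> I"
  by (induction X rule: infinite_finite_induct) (auto intro: I_0 I_add)

lemma I_mult: "s \<in> I \<Longrightarrow> t * s \<in> I"
proof (induction t rule: poly_mapping_single_induct)
  case (single a c)
  have "basis x * (Poly_Mapping.single a c * s) = const c * (basis (x + a) * s)" for x
    by (simp add: mult_single flip: mult.assoc)
  then show ?case using single by (simp add: I_def coset_sum_const)
qed (auto simp: distrib_right intro: I_add)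

lemma basis_diff_in_I: "basis ((g ^^ i) a) - basis a \<in> I"
proof -
  have "x + (g ^^ i) a \<in> T \<longleftrightarrow> x + a \<in> T" for x
    using T_add[OF _ T_g_pow[of i a], of "x + a"] T_diff[OF _ T_g_pow[of i a], of "x + (g ^^ i) a"]
    by auto
  then have "coset_sum (basis x * basis ((g ^^ i) a) + basis x * - basis a) = 0" for x
    unfolding coset_sum_add by (simp add: mult_single coset_sum_single flip: single_uminus)
  then show ?thesis by (simp add: I_def right_diff_distrib)
qed

text \<open>The denominator bound is used at e^a and at e^c, with c chosen to make the two products
  of binomials coprime. Comparing the two fractions, the squared denominator
  \<open>?\<beta> ^ 2\<close> is cancelled one factor at a time.\<close>

lemma extended_derivation_integral:
  assumes E: "cyc.derivation_on (range frac_embed) E"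
    and ext: "\<And>r. r \<in> Inv \<Longrightarrow> E (frac_embed r) = frac_embed (D r)"
    and a: "g a \<noteq> a"
  shows "E (frac_embed s) \<in> range frac_embed"
proof -
  obtain c where c: "g c \<noteq> c"
    and np: "\<And>i j. i \<in> {1..<p} \<Longrightarrow> j \<in> {1..<p} \<Longrightarrow> non_parallel ((g ^^ i) c - c) ((g ^^ j) a - a)"
    using exists_non_parallel_orbit[OF a] by blast
  have D: "cyc.derivation_on cyc.R E"
    using E unfolding cyc.derivation_on_def cyc_R by blast
  have bound: "\<exists>t. E (frac_embed s) * frac_embed (orbit_binomials b ^ 2) = frac_embed t" if b: "g b \<noteq> b" for b
  proof -
    have reg: "inj_on (\<lambda>i. (lift \<gamma> ^^ i) (frac_embed (basis b))) {..<p}"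
      using inj_on_g_pow[OF b] by (auto simp: lift_\<gamma>_pow inj_on_def single_one_eq_iff)
    have "E (frac_embed s) * cyc.different (frac_embed (basis b)) ^ 2 \<in> range frac_embed"
      using cyc.denominator_bound[OF D _ reg E, of "frac_embed s"] ext by (auto simp: cyc_R)
    then obtain t where t: "E (frac_embed s) * cyc.different (frac_embed (basis b)) ^ 2 = frac_embed t" by blast
    let ?v = "basis (- b) ^ (p - 1)" and ?u = "basis b ^ (p - 1)"
    have uv1: "?u * ?v = 1" by (simp add: mult_single flip: power_mult_distrib)
    have "(?u * orbit_binomials b) ^ 2 * ?v ^ 2 = (?u * ?v) ^ 2 * orbit_binomials b ^ 2"
      by (simp only: power2_eq_square ac_simps)
    then have uv: "(?u * orbit_binomials b) ^ 2 * ?v ^ 2 = orbit_binomials b ^ 2"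
      by (simp only: uv1 power_one mult_1)
    have "E (frac_embed s) * frac_embed (orbit_binomials b ^ 2)
        = E (frac_embed s) * frac_embed (?u * orbit_binomials b) ^ 2 * frac_embed (?v ^ 2)"
      unfolding uv[symmetric] by (simp only: frac_embed_mult frac_embed_power mult.assoc)
    also have "\<dots> = frac_embed (t * ?v ^ 2)"
      unfolding different_basis[symmetric] t by (simp only: frac_embed_mult)
    finally show ?thesis by blast
  qed
  let ?\<alpha> = "orbit_binomials a" and ?\<beta> = "orbit_binomials c"
  obtain t where t: "E (frac_embed s) * frac_embed (?\<alpha> ^ 2) = frac_embed t" using bound[OF a] by blast
  obtain t' where t': "E (frac_embed s) * frac_embed (?\<beta> ^ 2) = frac_embed t'" using bound[OF c] by blast
  have nz: "?\<beta> \<noteq> 0"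
  proof -
    have "(g ^^ i) c - c \<noteq> 0" if "i \<in> {1..<p}" for i
      using g_pow_regular[OF c, of i] that by auto
    then have "frac_embed (1 - basis ((g ^^ i) c - c)) \<noteq> 0" if "i \<in> {1..<p}" for i
      using that binomial_nonzero[of "(g ^^ i) c - c"] frac_embed_eq_iff[of _ 0] frac_embed_0 by metis
    then have "frac_embed ?\<beta> \<noteq> 0" unfolding orbit_binomials_def frac_embed_prod by simp
    then show ?thesis by auto
  qed
  have "frac_embed (?\<alpha> ^ 2 * t') = frac_embed (?\<beta> ^ 2 * t)"
    unfolding frac_embed_mult t[symmetric] t'[symmetric] by (simp add: ac_simps)
  then have eq: "?\<alpha> ^ 2 * t' = ?\<beta> ^ 2 * t" by simp
  have cop: "?\<beta> dvd z" if "?\<beta> dvd ?\<alpha> * z" for z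
    using orbit_binomials_coprime[OF c np that] .
  have "?\<alpha> * (?\<alpha> * t') = ?\<beta> * (?\<beta> * t)"
    using eq unfolding power2_eq_square mult.assoc .
  then have "?\<beta> dvd ?\<alpha> * (?\<alpha> * t')" by (simp only: dvd_triv_left)
  then have "?\<beta> dvd t'" by (rule cop[OF cop])
  then obtain w where w: "t' = ?\<beta> * w" by (rule dvdE)
  have "?\<beta> * (?\<alpha> ^ 2 * w) = ?\<beta> * (?\<beta> * t)"
    using eq by (simp only: w power2_eq_square ac_simps)
  then have "?\<alpha> ^ 2 * w = ?\<beta> * t" by (rule mult_cancel[OF nz])
  then have "?\<alpha> * (?\<alpha> * w) = ?\<beta> * t"
    unfolding power2_eq_square mult.assoc .
  then have "?\<beta> dvd ?\<alpha> * (?\<alpha> * w)" by (simp only: dvd_triv_left)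
  then have "?\<beta> dvd w" by (rule cop[OF cop])
  then obtain v where v: "w = ?\<beta> * v" by (rule dvdE)
  then have "E (frac_embed s) * frac_embed (?\<beta> ^ 2) = frac_embed v * frac_embed (?\<beta> ^ 2)"
    unfolding t' w v by (simp only: power2_eq_square frac_embed_mult[symmetric] ac_simps)
  moreover have "frac_embed (?\<beta> ^ 2) \<noteq> 0"
    using nz frac_embed_eq_iff[of ?\<beta> 0] by (simp add: frac_embed_mult power2_eq_square del: frac_embed_eq_iff)
  ultimately show ?thesis by simp
qed

text \<open>
  The extension of \<open>D\<close> to \<open>k[A]\<close> has the form \<open>e\<^sup>b \<mapsto> e\<^sup>b w b\<close> with \<open>w\<close> additive, so modulo \<open>I\<close>
  the orbit sum of \<open>b\<close> is mapped to \<open>e\<^sup>b w (trace b) = 0\<close>.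
\<close>

theorem derivation_into_I:
  assumes D_add: "\<And>r s. r \<in> Inv \<Longrightarrow> s \<in> Inv \<Longrightarrow> D (r + s) = D r + D s"
    and D_mult: "\<And>r s. r \<in> Inv \<Longrightarrow> s \<in> Inv \<Longrightarrow> D (r * s) = D r * s + r * D s"
    and D_single: "\<And>u c. g u = u \<Longrightarrow> D (Poly_Mapping.single u c) = 0"
    and r: "r \<in> Inv"
  shows "D r \<in> I"
proof -
  obtain a where a: "g a \<noteq> a" using g_nontrivial by blast
  have reg: "inj_on (\<lambda>i. (lift \<gamma> ^^ i) (frac_embed (basis a))) {..<p}"
    using inj_on_g_pow[OF a] by (auto simp: lift_\<gamma>_pow inj_on_def single_one_eq_iff)
  have LD: "cyc.derivation_on cyc.R (lift D)"
    unfolding cyc.derivation_on_def cyc_R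
    by (auto simp: D_add D_mult simp flip: frac_embed_add frac_embed_mult)
  obtain E where E: "cyc.derivation_on (range frac_embed) E"
    and ext: "\<And>x. x \<in> cyc.R \<Longrightarrow> E x = lift D x"
    using cyc.extension_derivation[OF LD _ reg] cyc.extension_extends[OF LD _ reg] by blast
  have ext': "E (frac_embed s) = frac_embed (D s)" if "s \<in> Inv" for s
    using ext[of "frac_embed s"] that by (simp add: cyc_R)
  have E_add: "E (frac_embed (s + t)) = E (frac_embed s) + E (frac_embed t)"
    and E_mult: "E (frac_embed (s * t)) = E (frac_embed s) * frac_embed t + frac_embed s * E (frac_embed t)" for s t
    using E by (simp_all add: cyc.derivation_on_def frac_embed_add frac_embed_mult)
  have E_sum: "E (frac_embed (sum h X)) = (\<Sum>x\<in>X. E (frac_embed (h x)))" if "finite X" for h :: "nat \<Rightarrow> _" and X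
    using that
  proof induction
    case empty
    show ?case
      using E_add[of 0 0] by (metis add.right_neutral add_cancel_left_left sum.empty)
  qed (simp add: E_add)
  have "\<exists>t. E (frac_embed (basis b)) = frac_embed t" for b
    using extended_derivation_integral[OF E ext' a, of "basis b"] by (simp only: image_iff bex_UNIV)
  then obtain W where W: "E (frac_embed (basis b)) = frac_embed (W b)" for b
    by metis
  define w where "w b = basis (- b) * W b" for b
  have W_w: "W b = basis b * w b" for b
    by (simp add: w_def mult_single flip: mult.assoc)
  have w_add: "w (b + c) = w b + w c" for b c
  proof -
    have "frac_embed (W (b + c)) = frac_embed (W b * basis c + basis b * W c)"
      using E_mult[of "basis b" "basis c"] by (simp add: W mult_single frac_embed_add frac_embed_mult)
    then have "basis (b + c) * w (b + c) = (basis b * basis c) * (w b + w c)"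
      by (simp add: W_w distrib_left ac_simps)
    then have eq: "basis (b + c) * w (b + c) = basis (b + c) * (w b + w c)"
      by (simp add: mult_single)
    have "basis (b + c) \<noteq> 0"
      by (metis lookup_single_eq lookup_zero zero_neq_one)
    then show ?thesis using eq by (rule mult_cancel)
  qed
  have w_sum: "w (sum h X) = (\<Sum>x\<in>X. w (h x))" if "finite X" for h :: "nat \<Rightarrow> _" and X
    using that
  proof induction
    case empty
    show ?case
      using w_add[of 0 0] by (metis add.right_neutral add_cancel_left_left sum.empty)
  qed (simp add: w_add)
  have w_fixed: "w u = 0" if "g u = u" for u
  proof -
    have "frac_embed (W u) = frac_embed 0"
      using ext'[OF Inv_single[OF that]] D_single[OF that] by (simp add: W[symmetric])
    then have "W u = 0" by (simp only: frac_embed_eq_iff)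
    then show ?thesis by (simp add: w_def)
  qed
  have orb: "D (orbit_sum b) \<in> I" for b
  proof -
    have "frac_embed (D (orbit_sum b)) = frac_embed (\<Sum>i<p. basis ((g ^^ i) b) * w ((g ^^ i) b))"
    proof -
      have "E (frac_embed (orbit_sum b)) = (\<Sum>i<p. E (frac_embed (basis ((g ^^ i) b))))"
        unfolding orbit_sum_def by (rule E_sum) simp
      then show ?thesis
        unfolding ext'[OF orbit_sum_Inv] by (simp only: W W_w frac_embed_sum)
    qed
    then have "D (orbit_sum b) = (\<Sum>i<p. basis ((g ^^ i) b) * w ((g ^^ i) b))" by simp
    \<comment> \<open>Replacing e^(g^i b) by e^b costs an element of \<open>I\<close>; by additivity
      the coefficients of e^b add up to \<open>w (trace b)\<close>.\<close>
    also have "\<dots> = (\<Sum>i<p. w ((g ^^ i) b) * (basis ((g ^^ i) b) - basis b)) + basis b * w (trace b)"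
      by (simp add: trace_def w_sum sum_distrib_left sum.distrib[symmetric] algebra_simps)
    also have "w (trace b) = 0" by (rule w_fixed) (rule g_trace)
    finally show ?thesis by (auto intro!: I_sum I_mult basis_diff_in_I)
  qed
  have D_0: "D 0 = 0"
    using D_add[OF Inv_0 Inv_0] by (metis add.right_neutral add_cancel_left_left)
  have D_sum: "D (sum h X) = (\<Sum>x\<in>X. D (h x))" if "finite X" "\<And>x. h x \<in> Inv" for h :: "'a \<Rightarrow> _" and X
    using that by induction (simp_all add: D_0 D_add Inv_sum)
  \<comment> \<open>Constants are monomials with the fixed exponent 0, so \<open>D\<close> kills
    them and is k-linear on the invariants.\<close>
  have D_const: "D (const c * s) = const c * D s" if "s \<in> Inv" for c s
    using D_mult[OF Inv_single[of 0 c] that] D_single[of 0 c] by simp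
  let ?h = "\<lambda>a. const (Poly_Mapping.lookup r a / of_nat p) * orbit_sum a"
  have h: "?h b \<in> Inv" for b
    by (intro Inv_mult Inv_single orbit_sum_Inv) simp
  have "D r = (\<Sum>a\<in>Poly_Mapping.keys r. D (?h a))"
    using orbit_sum_expansion[OF r] D_sum[OF finite_keys, of ?h r] h by metis
  also have "\<dots> \<in> I"
    by (intro I_sum) (simp add: D_const[OF orbit_sum_Inv] I_mult orb)
  finally show ?thesis .
qed

end

subsection \<open>The monoid basis of the ring of invariants\<close>

text \<open>The coordinate at \<open>x\<close> in a basis containing \<open>x\<close>. It will bring
  logarithmic derivatives from the field of fractions down to k.\<close>

lemma exists_additive_functional:
  fixes scale :: "'k::field \<Rightarrow> 'v::ab_group_add \<Rightarrow> 'v"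
  assumes "vector_space scale" and "x \<noteq> 0"
  shows "\<exists>\<chi> :: 'v \<Rightarrow> 'k. (\<forall>y z. \<chi> (y + z) = \<chi> y + \<chi> z) \<and> \<chi> x \<noteq> 0"
proof -
  interpret vector_space scale by fact
  have ind: "independent {x}" using \<open>x \<noteq> 0\<close> by simp
  let ?B = "extend_basis {x}"
  have B: "independent ?B" "x \<in> ?B"
    using independent_extend_basis[OF ind] extend_basis_superset[OF ind] by auto
  show ?thesis
    by (rule exI[of _ "\<lambda>y. representation ?B y x"])
      (simp add: representation_add[OF B(1)] span_extend_basis[OF ind] representation_basis[OF B])
qed

context lattice_invariants
begin

lemma keys_single_mult:
  assumes "c \<noteq> 0"
  shows "Poly_Mapping.keys (Poly_Mapping.single u c * s) = (+) u ` Poly_Mapping.keys (s :: 'a \<Rightarrow>\<^sub>0 'k)"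
proof -
  have sub: "Poly_Mapping.keys (Poly_Mapping.single v d * t) \<subseteq> (+) v ` Poly_Mapping.keys t" for v d
    and t :: "'a \<Rightarrow>\<^sub>0 'k"
    using keys_mult[of "Poly_Mapping.single v d" t] by (auto split: if_splits)
  have "s = Poly_Mapping.single (- u) (inverse c) * (Poly_Mapping.single u c * s)"
    using assms by (simp add: mult_single flip: mult.assoc)
  then have "Poly_Mapping.keys s \<subseteq> (+) (- u) ` Poly_Mapping.keys (Poly_Mapping.single u c * s)"
    using sub by metis
  then have "(+) u ` Poly_Mapping.keys s \<subseteq> Poly_Mapping.keys (Poly_Mapping.single u c * s)"
    by (auto dest!: subsetD)
  then show ?thesis using sub by blast
qed

text \<open>If s p + t q = 1 and p a = trace a + q b, then a = s trace a + q (s b + t a), and the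
  trace is fixed.\<close>

lemma fixed_plus_multiple:
  assumes q: "prime q" "coprime p q" and dvd: "\<And>k. int q dvd coord (nat_times p a - trace a) k"
  shows "\<exists>u b. g u = u \<and> a = u + nat_times q b"
proof -
  define x where "x = nat_times p a - trace a"
  define b :: "nat \<Rightarrow>\<^sub>0 int" where "b = Poly_Mapping.map (\<lambda>c. c div int q) (\<iota> x)"
  have b: "Poly_Mapping.lookup b k = coord x k div int q" for k
    by (simp add: b_def map.rep_eq when_def)
  have "Poly_Mapping.keys b \<subseteq> {..<n}"
  proof
    fix k assume "k \<in> Poly_Mapping.keys b"
    then have "coord x k \<noteq> 0" by (auto simp: b in_keys_iff)
    then show "k \<in> {..<n}" using coord_outside[of k x] by (meson lessThan_iff not_le)
  qed
  then obtain b' where "\<iota> b' = b" using range_\<iota> by (metis (mono_tags, lifting) imageE mem_Collect_eq)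
  then have xb: "x = nat_times q b'"
    using dvd by (intro coord_eqI) (simp add: b x_def[symmetric])
  obtain s t where st: "s * int p + t * int q = 1"
    using q(2) bezout_int[of "int p" "int q"] by (auto simp: coprime_iff_gcd_eq_1)
  have "a = int_times s (trace a) + nat_times q (int_times s b' + int_times t a)"
  proof (rule coord_eqI)
    fix k
    have "int p * coord a k = coord (trace a) k + int q * coord b' k"
      using arg_cong[OF xb, of "\<lambda>y. coord y k"] by (simp add: x_def)
    moreover have "coord a k = s * (int p * coord a k) + t * int q * coord a k"
      using st by (metis distrib_right mult.assoc mult_1)
    ultimately show "coord a k = coord (int_times s (trace a) + nat_times q (int_times s b' + int_times t a)) k"
      by (simp add: algebra_simps)
  qed
  moreover have "g (int_times s (trace a)) = int_times s (trace a)"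
    by (simp add: g_int_times g_trace)
  ultimately show ?thesis by blast
qed

text \<open>Additive with kernel A^G: its coordinates, read in k, are the source of derivations that
  kill k[A^G].\<close>

definition defect :: "'a \<Rightarrow> 'a"
  where "defect a = nat_times p a - trace a"

lemma defect_add: "defect (a + b) = defect a + defect b"
  by (rule coord_eqI) (simp add: defect_def trace_add algebra_simps)

lemma defect_eq_0: "defect a = 0 \<longleftrightarrow> g a = a"
  by (simp add: defect_def g_fixed_iff)

lemma defect_nat_times: "defect (nat_times m a) = nat_times m (defect a)"
  by (rule coord_eqI) (simp add: defect_def trace_nat_times algebra_simps)

section \<open>The image of the monoid in the invariants\<close>

context
  fixes F :: "('m::comm_monoid_add \<Rightarrow>\<^sub>0 'k) \<Rightarrow> ('a \<Rightarrow>\<^sub>0 'k)"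
  assumes iso: "algebra_iso_onto F Inv"
begin

lemma F_add: "F (x + y) = F x + F y"
  and F_mult: "F (x * y) = F x * F y"
  and F_1: "F 1 = 1"
  and F_const: "F (Poly_Mapping.single 0 c * x) = const c * F x"
  and F_Inv: "F x \<in> Inv"
  and F_inj: "F x = F y \<Longrightarrow> x = y"
  using iso unfolding algebra_iso_onto_def bij_betw_def algebra_scale_conv_mult
  by (auto dest: injD)

lemma F_surj: "r \<in> Inv \<Longrightarrow> \<exists>x. F x = r"
  using iso unfolding algebra_iso_onto_def bij_betw_def by (metis imageE)

lemma F_0: "F 0 = 0"
  using F_add[of 0 0] by (metis add.right_neutral add_cancel_left_left)

lemma F_eq_0: "F x = 0 \<longleftrightarrow> x = 0"
  using F_inj[of x 0] F_0 by auto

lemma F_sum: "F (sum h X) = (\<Sum>x\<in>X. F (h x))"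
  by (induction X rule: infinite_finite_induct) (simp_all add: F_0 F_add)

lemma F_power: "F (x ^ i) = F x ^ i"
  by (induction i) (simp_all add: F_1 F_mult)

definition X :: "'m \<Rightarrow> ('a \<Rightarrow>\<^sub>0 'k)"
  where "X m = F (Poly_Mapping.single m 1)"

lemma X_add: "X (m + m') = X m * X m'"
  by (simp add: X_def mult_single flip: F_mult)

lemma X_nonzero: "X m \<noteq> 0"
  unfolding X_def F_eq_0 by (metis lookup_single_eq lookup_zero zero_neq_one)

lemma F_single: "F (Poly_Mapping.single m c) = const c * X m"
  unfolding X_def F_const[symmetric] by (simp add: mult_single)

lemma F_expansion: "F x = (\<Sum>m\<in>Poly_Mapping.keys x. const (Poly_Mapping.lookup x m) * X m)"
  using F_sum[of "\<lambda>m. Poly_Mapping.single m (Poly_Mapping.lookup x m)" "Poly_Mapping.keys x"]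
  by (simp add: poly_mapping_sum_single F_single)

text \<open>The top parts of \<open>x\<close> and \<open>y\<close> have nonzero images under
  \<open>F\<close> in the domain k[A], so their product is nonzero. The sum of the top degrees
  therefore occurs in 1, whose only degree is 0.\<close>

lemma unit_level:
  fixes w :: "'m \<Rightarrow> nat \<Rightarrow>\<^sub>0 int" and x y :: "'m \<Rightarrow>\<^sub>0 'k"
  assumes w: "\<And>m m'. w (m + m') = w m + w m'" and xy: "x * y = 1"
  shows "top_exponent w x + top_exponent w y = 0"
proof -
  have x: "x \<noteq> 0" and y: "y \<noteq> 0" using xy by auto
  have level: "level_part w (top_exponent w z) z \<noteq> 0" if nz: "z \<noteq> 0" for z :: "'m \<Rightarrow>\<^sub>0 'k"
  proof -
    obtain m where m: "m \<in> Poly_Mapping.keys z" "w m = top_exponent w z"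
      using top_exponent_attained[OF nz] by blast
    then have "Poly_Mapping.lookup (level_part w (top_exponent w z) z) m \<noteq> 0"
      by (simp add: in_keys_iff)
    then show ?thesis by (metis lookup_zero)
  qed
  have "F (level_part w (top_exponent w x) x) * F (level_part w (top_exponent w y) y) \<noteq> 0"
    using no_zero_divisors level[OF x] level[OF y] F_eq_0 by metis
  then have "level_part w (top_exponent w x) x * level_part w (top_exponent w y) y \<noteq> 0"
    unfolding F_mult[symmetric] F_eq_0 .
  from top_level_mult[OF w top_exponent_ge top_exponent_ge this]
  have "w 0 = top_exponent w x + top_exponent w y" by (simp add: xy)
  moreover have "w 0 = 0" using w[of 0 0] by (metis add.right_neutral add_cancel_left_left)
  ultimately show ?thesis by simp
qed

text \<open>
  The grading of \<open>k[M]\<close> by the leading exponent of \<open>X m\<close>: the highest degrees of \<open>x\<close> and its inverse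
  cancel, and so do the lowest ones, so \<open>x\<close> is homogeneous.
\<close>

lemma unit_homogeneous:
  fixes v :: "'a \<Rightarrow> nat \<Rightarrow>\<^sub>0 int"
  assumes v: "\<And>a b. v (a + b) = v a + v b" and inj: "inj v"
    and x: "F x = basis u" and y: "F y = basis (- u)" and m: "m \<in> Poly_Mapping.keys x"
  shows "top_exponent v (X m) = v u"
proof -
  let ?w = "\<lambda>m. top_exponent v (X m)"
  have w: "?w (m + m') = ?w m + ?w m'" for m m'
    unfolding X_add by (rule top_exponent_mult(2)[OF v inj X_nonzero X_nonzero])
  have "F (x * y) = F 1" by (simp add: F_mult F_1 x y mult_single)
  then have xy: "x * y = 1" by (rule F_inj)
  have v_uminus: "v (- a) = - v a" for a
  proof -
    have "v 0 = 0" using v[of 0 0] by (metis add.right_neutral add_cancel_left_left)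
    then show ?thesis using v[of a "- a"] by (simp add: eq_neg_iff_add_eq_0 add.commute)
  qed
  have le: "v a \<le> top_exponent ?w z" if z: "F z = basis a" for z a
  proof -
    have "a \<in> Poly_Mapping.keys (\<Sum>m\<in>Poly_Mapping.keys z. const (Poly_Mapping.lookup z m) * X m)"
      unfolding F_expansion[symmetric] z by simp
    then obtain m where m: "m \<in> Poly_Mapping.keys z"
      "a \<in> Poly_Mapping.keys (const (Poly_Mapping.lookup z m) * X m)"
      using keys_sum by fastforce
    then have "a \<in> Poly_Mapping.keys (X m)" by (simp add: keys_const_mult in_keys_iff)
    then have "v a \<le> ?w m" by (rule top_exponent_ge)
    also have "\<dots> \<le> top_exponent ?w z" using m(1) by (rule top_exponent_ge)
    finally show ?thesis .
  qed
  \<comment> \<open>\<open>d\<close> and \<open>d'\<close> are the highest degrees of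
    \<open>x\<close> and \<open>y\<close>; \<open>- e\<close> and \<open>- e'\<close> are the
    lowest, obtained as highest degrees of the negated grading.\<close>
  define d where "d = top_exponent ?w x"
  define d' where "d' = top_exponent ?w y"
  define e where "e = top_exponent (\<lambda>m. - ?w m) x"
  define e' where "e' = top_exponent (\<lambda>m. - ?w m) y"
  have "d + d' = 0" unfolding d_def d'_def by (rule unit_level[OF w xy])
  moreover have "e + e' = 0"
    unfolding e_def e'_def by (rule unit_level[OF _ xy]) (simp add: w)
  moreover have "v u \<le> d" "- v u \<le> d'"
    using le[OF x] le[OF y] by (simp_all add: d_def d'_def v_uminus)
  moreover have "?w m \<le> d" "- ?w m \<le> e"
    unfolding d_def e_def
    using top_exponent_ge[OF m, of ?w] top_exponent_ge[OF m, of "\<lambda>m. - ?w m"] by auto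
  moreover obtain m' where m': "m' \<in> Poly_Mapping.keys y"
    using xy by (metis all_not_in_conv in_keys_iff lookup_zero mult_zero_right poly_mapping_eqI zero_neq_one)
  moreover have "?w m' \<le> d'" "- ?w m' \<le> e'"
    unfolding d'_def e'_def
    using top_exponent_ge[OF m', of ?w] top_exponent_ge[OF m', of "\<lambda>m. - ?w m"] by auto
  moreover have d': "d' = - d" using \<open>d + d' = 0\<close> by (simp add: eq_neg_iff_add_eq_0 add.commute)
  moreover have e': "e' = - e" using \<open>e + e' = 0\<close> by (simp add: eq_neg_iff_add_eq_0 add.commute)
  ultimately have "v u \<le> d" "d \<le> v u" "?w m \<le> d" "- e \<le> ?w m" "e \<le> ?w m'" "?w m' \<le> - d"
    using minus_le_iff[of "?w m" e] by auto
  moreover have "d \<le> - e"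
    using order_trans[OF \<open>e \<le> ?w m'\<close> \<open>?w m' \<le> - d\<close>] by (simp add: le_minus_iff)
  ultimately show ?thesis by (meson order_antisym order_trans)
qed

text \<open>e^u is a unit of the invariants, so homogeneity applies to the order given by \<iota>
  and to its reverse. For \<open>m\<close> in the support of the preimage of e^u, the highest and
  the lowest exponent of \<open>X m\<close> are then both u.\<close>

lemma fixed_basis_element:
  assumes u: "g u = u"
  shows "\<exists>m c. c \<noteq> 0 \<and> F (Poly_Mapping.single m c) = basis u \<and> X m = Poly_Mapping.single u (inverse c)"
proof -
  obtain x where x: "F x = basis u" using F_surj[OF Inv_single[OF u]] by blast
  obtain y where y: "F y = basis (- u)" using F_surj[OF Inv_single[of "- u"]] u by (auto simp: g_uminus)
  have "x \<noteq> 0" using x F_0 by (metis lookup_single_eq lookup_zero zero_neq_one)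
  then obtain m where m: "m \<in> Poly_Mapping.keys x"
    by (metis all_not_in_conv in_keys_iff lookup_zero poly_mapping_eqI)
  have "a = u" if a: "a \<in> Poly_Mapping.keys (X m)" for a
  proof -
    have "\<iota> a \<le> \<iota> u"
      using top_exponent_ge[OF a, of \<iota>] unit_homogeneous[OF \<iota>_add inj_\<iota> x y m] by simp
    moreover have "- \<iota> a \<le> - \<iota> u"
      using top_exponent_ge[OF a, of "\<lambda>a. - \<iota> a"] unit_homogeneous[OF _ _ x y m, of "\<lambda>a. - \<iota> a"] inj_\<iota>
      by (simp add: \<iota>_add inj_def)
    ultimately have "\<iota> a = \<iota> u" by simp
    then show ?thesis using inj_\<iota> by (rule injD[rotated])
  qed
  then have keys: "Poly_Mapping.keys (X m) \<subseteq> {u}" by blast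
  define c where "c = Poly_Mapping.lookup (X m) u"
  have Xm: "X m = Poly_Mapping.single u c"
    unfolding c_def using keys by (intro poly_mapping_eqI) (auto simp: lookup_single when_def in_keys_iff)
  then have "c \<noteq> 0" using X_nonzero[of m] by auto
  then have "F (Poly_Mapping.single m (inverse c)) = basis u"
    by (simp add: F_single Xm mult_single)
  then show ?thesis using Xm \<open>c \<noteq> 0\<close>
    by (intro exI[of _ m] exI[of _ "inverse c"]) simp
qed

definition D_of :: "('m \<Rightarrow> 'k) \<Rightarrow> ('a \<Rightarrow>\<^sub>0 'k) \<Rightarrow> ('a \<Rightarrow>\<^sub>0 'k)"
  where "D_of \<delta> r = F (euler \<delta> (inv_into UNIV F r))"

lemma D_of_F: "D_of \<delta> (F x) = F (euler \<delta> x)"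
proof -
  have "inj F" using F_inj by (auto intro: injI)
  then show ?thesis by (simp add: D_of_def inv_into_f_f)
qed

text \<open>\<open>X m\<close> is an eigenvector of \<open>D_of \<delta>\<close> with eigenvalue
  \<open>\<delta> m\<close>. By \<open>fixed\<close> this derivation vanishes on k[A^G], because
  each e^u with u fixed is a scalar multiple of some \<open>X m\<close>.\<close>

lemma X_in_I_of_grading:
  fixes \<delta> :: "'m \<Rightarrow> 'k"
  assumes \<delta>: "\<And>m m'. \<delta> (m + m') = \<delta> m + \<delta> m'"
    and fixed: "\<And>m u c. g u = u \<Longrightarrow> X m = Poly_Mapping.single u c \<Longrightarrow> \<delta> m = 0"
    and nz: "\<delta> m \<noteq> 0"
  shows "X m \<in> I"
proof -
  have "D_of \<delta> (X m) \<in> I"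
  proof (rule derivation_into_I[of "D_of \<delta>"])
    show "X m \<in> Inv" unfolding X_def by (rule F_Inv)
    show "D_of \<delta> (r + s) = D_of \<delta> r + D_of \<delta> s"
      "D_of \<delta> (r * s) = D_of \<delta> r * s + r * D_of \<delta> s"
      if rs: "r \<in> Inv" "s \<in> Inv" for r s
    proof -
      obtain x y where "r = F x" "s = F y" using F_surj rs by metis
      then show "D_of \<delta> (r + s) = D_of \<delta> r + D_of \<delta> s"
        "D_of \<delta> (r * s) = D_of \<delta> r * s + r * D_of \<delta> s"
        by (simp_all add: D_of_F euler_add euler_mult \<delta> flip: F_add F_mult)
    qed
    fix u and c :: 'k assume u: "g u = u"
    obtain m c' where m: "F (Poly_Mapping.single m c') = basis u" "X m = Poly_Mapping.single u (inverse c')"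
      using fixed_basis_element[OF u] by blast
    have "Poly_Mapping.single u c = F (Poly_Mapping.single m (c * c'))"
      using arg_cong[OF m(1), of "\<lambda>s. const c * s"] by (simp add: mult_single flip: F_const)
    then show "D_of \<delta> (Poly_Mapping.single u c) = 0"
      using fixed[OF u m(2)] by (simp add: D_of_F F_0)
  qed
  then have "const (\<delta> m) * X m \<in> I"
    unfolding X_def[of m] D_of_F by (simp add: F_single)
  then have "const (inverse (\<delta> m)) * (const (\<delta> m) * X m) \<in> I" by (rule I_mult)
  then show ?thesis using nz by (simp add: mult_single flip: mult.assoc)
qed

text \<open>
  The logarithmic derivative \<open>m \<mapsto> \<partial>(X m) / X m\<close> is additive with values in the field of
  fractions; composing it with a functional gives a grading of \<open>k[M]\<close> by \<open>k\<close>.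
\<close>

lemma X_in_I_of_derivative:
  fixes \<kappa> :: "'a \<Rightarrow> 'k"
  assumes \<kappa>: "\<And>a b. \<kappa> (a + b) = \<kappa> a + \<kappa> b" and fixed: "\<And>u. g u = u \<Longrightarrow> \<kappa> u = 0"
    and nz: "euler \<kappa> (X m) \<noteq> 0"
  shows "X m \<in> I"
proof -
  define q where "q m = frac_embed (euler \<kappa> (X m)) / frac_embed (X m)" for m
  have X_nz: "frac_embed (X m) \<noteq> 0" for m
    using X_nonzero[of m] frac_embed_eq_iff[of "X m" 0] by simp
  have q_add: "q (m + m') = q m + q m'" for m m'
    using X_nz[of m] X_nz[of m']
    by (simp add: q_def X_add euler_mult \<kappa> frac_embed_add frac_embed_mult add_divide_distrib)
  have "frac_embed (euler \<kappa> (X m)) \<noteq> 0"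
    using nz frac_embed_eq_iff[of "euler \<kappa> (X m)" 0] by simp
  then have qm: "q m \<noteq> 0" using X_nz[of m] by (simp add: q_def)
  have "vector_space (\<lambda>c x. frac_embed (const c) * x)"
    by unfold_locales
      (simp_all add: algebra_simps frac_embed_add single_add mult_single flip: frac_embed_mult mult.assoc)
  from exists_additive_functional[OF this qm]
  obtain \<chi> :: "((nat \<Rightarrow>\<^sub>0 int) \<Rightarrow>\<^sub>0 'k) fract \<Rightarrow> 'k"
    where \<chi>: "\<And>y z. \<chi> (y + z) = \<chi> y + \<chi> z" "\<chi> (q m) \<noteq> 0"
    by blast
  show ?thesis
  proof (rule X_in_I_of_grading[of "\<lambda>m. \<chi> (q m)"])
    fix m' u c assume "g u = u" "X m' = Poly_Mapping.single u c"
    then have "q m' = 0" by (simp add: q_def fixed)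
    then show "\<chi> (q m') = 0"
      using \<chi>(1)[of 0 0] by (metis add.right_neutral add_cancel_left_left)
  qed (simp_all add: q_add \<chi>)
qed

section \<open>Descent along Frobenius\<close>

definition weight :: "'m \<Rightarrow> nat"
  where "weight m = (\<Sum>a\<in>Poly_Mapping.keys (X m). norm1 (defect a))"

text \<open>If a = u + q b with u fixed, the orbit sum of a is e^u times the q-th power of that of
  b. Expanding \<open>X m\<close> in orbit sums and pulling back along \<open>F\<close>, the
  monomial of \<open>m\<close> must occur in one of the summands, each a monomial times a q-th
  power; there every exponent is of the form M a + q m'.\<close>

lemma X_frobenius_descent:
  assumes q: "prime CHAR('k)"
    and dec: "\<And>a. a \<in> Poly_Mapping.keys (X m) \<Longrightarrow> \<exists>u b. g u = u \<and> a = u + nat_times CHAR('k) b"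
  shows "\<exists>u c m'. g u = u \<and> c \<noteq> 0 \<and> X m = Poly_Mapping.single u c * X m' ^ CHAR('k)"
proof -
  let ?q = "CHAR('k)"
  obtain U B where UB: "\<And>a. a \<in> Poly_Mapping.keys (X m) \<Longrightarrow> g (U a) = U a \<and> a = U a + nat_times ?q (B a)"
    using dec by metis
  have "\<exists>m c. c \<noteq> 0 \<and> F (Poly_Mapping.single m c) = basis (U a) \<and> X m = Poly_Mapping.single (U a) (inverse c)"
    if "a \<in> Poly_Mapping.keys (X m)" for a
    using UB[OF that] by (intro fixed_basis_element) simp
  then obtain M C where MC: "\<And>a. a \<in> Poly_Mapping.keys (X m) \<Longrightarrow> C a \<noteq> 0 \<and>
      F (Poly_Mapping.single (M a) (C a)) = basis (U a) \<and>
      X (M a) = Poly_Mapping.single (U a) (inverse (C a))"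
    by metis
  have "\<exists>x. F x = orbit_sum (B a)" for a
    by (rule F_surj) (rule orbit_sum_Inv)
  then obtain \<omega> where \<omega>: "F (\<omega> a) = orbit_sum (B a)" for a
    by metis
  have orbit: "orbit_sum a = F (Poly_Mapping.single (M a) (C a) * \<omega> a ^ ?q)"
    if a: "a \<in> Poly_Mapping.keys (X m)" for a
  proof -
    have "orbit_sum (B a) ^ ?q = (\<Sum>i<p. basis ((g ^^ i) (B a)) ^ ?q)"
      unfolding orbit_sum_def by (rule freshmans_dream_sum) (simp_all add: q)
    then have "basis (U a) * orbit_sum (B a) ^ ?q =
        (\<Sum>i<p. basis (U a + nat_times ?q ((g ^^ i) (B a))))"
      by (simp add: single_power sum_distrib_left mult_single)
    also have "\<dots> = (\<Sum>i<p. basis ((g ^^ i) a))"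
    proof (rule sum.cong)
      fix i
      have Ua: "g (U a) = U a" and aeq: "U a + nat_times ?q (B a) = a"
        using UB[OF a] by simp_all
      have "(g ^^ i) (U a + nat_times ?q (B a)) = U a + nat_times ?q ((g ^^ i) (B a))"
        by (simp add: g_pow_add g_pow_fixed[OF Ua] g_pow_nat_times)
      then show "basis (U a + nat_times ?q ((g ^^ i) (B a))) = basis ((g ^^ i) a)"
        unfolding aeq by simp
    qed simp
    finally show ?thesis
      using MC[OF a] by (simp add: F_mult F_power \<omega> orbit_sum_def)
  qed
  let ?Y = "\<lambda>a. Poly_Mapping.single 0 (Poly_Mapping.lookup (X m) a / of_nat p) *
      (Poly_Mapping.single (M a) (C a) * \<omega> a ^ ?q)"
  have "X m \<in> Inv" unfolding X_def by (rule F_Inv)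
  have "F (Poly_Mapping.single m 1) = X m" by (simp add: X_def)
  also have "\<dots> = (\<Sum>a\<in>Poly_Mapping.keys (X m). const (Poly_Mapping.lookup (X m) a / of_nat p) * orbit_sum a)"
    using \<open>X m \<in> Inv\<close> by (rule orbit_sum_expansion)
  also have "\<dots> = (\<Sum>a\<in>Poly_Mapping.keys (X m). F (?Y a))"
    by (rule sum.cong) (simp_all only: orbit F_const)
  also have "\<dots> = F (\<Sum>a\<in>Poly_Mapping.keys (X m). ?Y a)" by (rule F_sum[symmetric])
  finally have single: "Poly_Mapping.single m 1 = (\<Sum>a\<in>Poly_Mapping.keys (X m). ?Y a)"
    by (rule F_inj)
  have "m \<in> Poly_Mapping.keys (Poly_Mapping.single m (1::'k))" by simp
  then have "m \<in> Poly_Mapping.keys (\<Sum>a\<in>Poly_Mapping.keys (X m). ?Y a)"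
    unfolding single .
  then obtain a where a: "a \<in> Poly_Mapping.keys (X m)" "m \<in> Poly_Mapping.keys (?Y a)"
    using keys_sum by fastforce
  then have "m \<in> Poly_Mapping.keys (Poly_Mapping.single (M a) (C a) * \<omega> a ^ ?q)"
    by (auto simp: in_keys_iff lookup_const_mult)
  then obtain m'' where m'': "m = M a + m''" "m'' \<in> Poly_Mapping.keys (\<omega> a ^ ?q)"
    using keys_mult[of "Poly_Mapping.single (M a) (C a)" "\<omega> a ^ ?q"] by (auto split: if_splits)
  then obtain m' where m': "m'' = nat_times ?q m'"
    using keys_frobenius[OF q, of "\<omega> a"] by blast
  have X_nat_times: "X (nat_times i m') = X m' ^ i" for i
    by (induction i) (simp_all add: X_add X_def[of 0] F_1 mult.commute)
  have "X m = Poly_Mapping.single (U a) (inverse (C a)) * X m' ^ ?q"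
    using MC[OF a(1)] by (simp add: m'' m' X_add X_nat_times)
  then show ?thesis using UB[OF a(1)] MC[OF a(1)]
    by (intro exI[of _ "U a"] exI[of _ "inverse (C a)"] exI[of _ m']) simp
qed

text \<open>If a coordinate of the defect is nonzero in k at some exponent of \<open>X m\<close>, it
  yields a derivation to which \<open>X_in_I_of_derivative\<close> applies. Otherwise the
  characteristic q divides all these defects and \<open>X m\<close> is a unit times the q-th power
  of some \<open>X m'\<close>. Then \<open>weight m\<close> is q times \<open>weight m'\<close>,
  which is nonzero as an exponent is still moved, so the descent ends.\<close>

lemma X_in_I:
  assumes "a \<in> Poly_Mapping.keys (X m)" "g a \<noteq> a"
  shows "X m \<in> I"
  using assms
proof (induction "weight m" arbitrary: m a rule: less_induct)
  case less
  let ?\<kappa> = "\<lambda>k b. of_int (coord (defect b) k) :: 'k"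
  show ?case
  proof (cases "\<exists>b\<in>Poly_Mapping.keys (X m). \<exists>k. ?\<kappa> k b \<noteq> 0")
    case True
    then obtain b k where b: "b \<in> Poly_Mapping.keys (X m)" "?\<kappa> k b \<noteq> 0" by blast
    show ?thesis
    proof (rule X_in_I_of_derivative[of "?\<kappa> k"])
      have "Poly_Mapping.lookup (euler (?\<kappa> k) (X m)) b \<noteq> 0"
        using b by (simp add: in_keys_iff)
      then show "euler (?\<kappa> k) (X m) \<noteq> 0" by (metis lookup_zero)
      show "?\<kappa> k u = 0" if "g u = u" for u
        using that by (simp add: defect_eq_0[THEN iffD2])
    qed (simp_all add: defect_add)
  next
    case False
    then have dvd: "int CHAR('k) dvd coord (defect b) k" if "b \<in> Poly_Mapping.keys (X m)" for b k
      using that by (simp add: of_int_eq_0_iff_char_dvd)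
    \<comment> \<open>In characteristic 0 the divisibility makes the defect of \<open>a\<close>
      vanish, although \<open>a\<close> is moved.\<close>
    have "CHAR('k) \<noteq> 0"
    proof
      assume "CHAR('k) = 0"
      then have "coord (defect a) k = coord 0 k" for k
        using dvd[OF less.prems(1), of k] by simp
      then have "defect a = 0" by (rule coord_eqI)
      then show False using less.prems(2) by (simp add: defect_eq_0)
    qed
    then have q: "prime CHAR('k)" by (simp add: prime_CHAR_semidom)
    have "\<not> CHAR('k) dvd p" using p_nonzero by (simp add: of_nat_eq_0_iff_char_dvd)
    then have cop: "coprime p CHAR('k)"
      by (subst coprime_commute) (rule prime_imp_coprime[OF q])
    obtain u c m' where m': "g u = u" "c \<noteq> 0" "X m = Poly_Mapping.single u c * X m' ^ CHAR('k)"
      using X_frobenius_descent[OF q] fixed_plus_multiple[OF q cop] dvd unfolding defect_def by blast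
    have inj: "inj (nat_times CHAR('k) :: 'a \<Rightarrow> 'a)"
      using \<open>CHAR('k) \<noteq> 0\<close> by (rule inj_nat_times)
    let ?f = "\<lambda>b. u + nat_times CHAR('k) b"
    have keys: "Poly_Mapping.keys (X m) = ?f ` Poly_Mapping.keys (X m')"
      unfolding m'(3) keys_single_mult[OF m'(2)] keys_frobenius_inj[OF q inj] by (simp add: image_image)
    have defect_f: "defect (?f b) = nat_times CHAR('k) (defect b)" for b
      using m'(1) by (simp add: defect_add defect_nat_times defect_eq_0[THEN iffD2])
    obtain b where b: "b \<in> Poly_Mapping.keys (X m')" "a = ?f b"
      using less.prems(1) unfolding keys by blast
    have gb: "g b \<noteq> b"
      using less.prems(2) m'(1) by (auto simp: b(2) g_add g_nat_times)
    have "inj_on ?f (Poly_Mapping.keys (X m'))"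
      using inj by (auto simp: inj_on_def dest: injD)
    then have w: "weight m = CHAR('k) * weight m'"
      unfolding weight_def keys by (simp add: sum.reindex defect_f norm1_nat_times sum_distrib_left)
    have "norm1 (defect b) \<noteq> 0" using gb by (simp add: norm1_eq_0 defect_eq_0)
    then have "weight m' \<noteq> 0" using b(1) by (auto simp: weight_def)
    then have "weight m' < weight m"
      unfolding w using prime_gt_1_nat[OF q] by simp
    then have "X m' \<in> I" using b(1) gb by (rule less.hyps)
    then have "(Poly_Mapping.single u c * X m' ^ (CHAR('k) - 1)) * X m' \<in> I" by (rule I_mult)
    moreover have "X m' ^ (CHAR('k) - 1) * X m' = X m' ^ CHAR('k)"
      using \<open>CHAR('k) \<noteq> 0\<close> by (intro power_minus_mult) simp
    then have "(Poly_Mapping.single u c * X m' ^ (CHAR('k) - 1)) * X m' = X m"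
      by (simp only: m'(3) mult.assoc)
    ultimately show ?thesis by simp
  qed
qed

text \<open>The sum of the coefficients on the coset a + T vanishes on every \<open>X m\<close>:
  either \<open>X m\<close> lies in \<open>I\<close>, or all its exponents are fixed and so lie in
  \<open>T\<close>. On the orbit sum of \<open>a\<close>, supported in a + T, it is p.\<close>

lemma no_monoid_basis: False
proof -
  obtain a where a: "a \<notin> T" using T_proper by blast
  obtain x where x: "F x = orbit_sum a" using F_surj[OF orbit_sum_Inv] by blast
  have X0: "coset_sum (basis (- a) * X m) = 0" for m
  proof (cases "\<exists>b\<in>Poly_Mapping.keys (X m). g b \<noteq> b")
    case True
    then show ?thesis using X_in_I unfolding I_def by blast
  next
    case False
    have "- a + b \<notin> T" if "b \<in> Poly_Mapping.keys (X m)" for b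
    proof
      assume "- a + b \<in> T"
      moreover have "b \<in> T" using False that by (intro T_fixed) blast
      ultimately have "b - (- a + b) \<in> T" by (intro T_diff)
      then show False using a by simp
    qed
    then have "coset_sum (basis (- a) * (\<Sum>b\<in>Poly_Mapping.keys (X m). Poly_Mapping.single b (Poly_Mapping.lookup (X m) b))) = 0"
      by (simp add: sum_distrib_left coset_sum_sum mult_single coset_sum_single)
    then show ?thesis by (simp only: poly_mapping_sum_single)
  qed
  have "coset_sum (basis (- a) * F x) = (\<Sum>m\<in>Poly_Mapping.keys x. coset_sum (basis (- a) * (const (Poly_Mapping.lookup x m) * X m)))"
    by (simp only: F_expansion sum_distrib_left coset_sum_sum)
  also have "\<dots> = (\<Sum>m\<in>Poly_Mapping.keys x. Poly_Mapping.lookup x m * coset_sum (basis (- a) * X m))"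
    by (simp only: mult.left_commute[of "basis (- a)"] coset_sum_const)
  finally have "coset_sum (basis (- a) * F x) = 0" by (simp add: X0)
  moreover have "coset_sum (basis (- a) * F x) = of_nat p"
    using T_g_pow[of _ a]
    by (simp add: x orbit_sum_def sum_distrib_left coset_sum_sum mult_single coset_sum_single)
  ultimately show False using p_nonzero by simp
qed

end
end

subsection \<open>Groups of odd prime order\<close>

lemma free_abelian_finite_rank_coordinates:
  assumes "free_abelian_finite_rank (additive_group TYPE('a::ab_group_add))"
  shows "\<exists>(\<iota> :: 'a \<Rightarrow> (nat \<Rightarrow>\<^sub>0 int)) n.
    (\<forall>a b. \<iota> (a + b) = \<iota> a + \<iota> b) \<and> inj \<iota> \<and> range \<iota> = {x. Poly_Mapping.keys x \<subseteq> {..<n}}"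
proof -
  obtain n \<iota> where "\<iota> \<in> Group.iso (additive_group TYPE('a)) (free_Abelian_group {..<n::nat})"
    using assms unfolding free_abelian_finite_rank_def is_iso_def by blast
  then have "\<iota> \<in> hom (additive_group TYPE('a)) (free_Abelian_group {..<n})"
    "bij_betw \<iota> (carrier (additive_group TYPE('a))) (carrier (free_Abelian_group {..<n}))"
    by (auto simp: Group.iso_def)
  then show ?thesis
    by (intro exI[of _ \<iota>] exI[of _ n])
      (auto simp: hom_def additive_group_def bij_betw_def free_Abelian_group_def)
qed

text \<open>On the whole type the restricted composition of \<open>BijGroup\<close> is ordinary
  composition, and the image of the identity is an injective idempotent map, hence
  \<open>id\<close>.\<close>

lemma AutoGroup_action:
  assumes "group G" and hom: "\<phi> \<in> hom G (AutoGroup (additive_group TYPE('a::ab_group_add)))"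
    and x: "x \<in> carrier G"
  shows "\<phi> x (a + b) = \<phi> x a + \<phi> x b"
    and "y \<in> carrier G \<Longrightarrow> \<phi> (x \<otimes>\<^bsub>G\<^esub> y) = \<phi> x \<circ> \<phi> y"
    and "\<phi> \<one>\<^bsub>G\<^esub> = id"
proof -
  interpret group G by fact
  have auto: "\<phi> z \<in> auto (additive_group TYPE('a))" if "z \<in> carrier G" for z
    using hom that by (auto simp: hom_def AutoGroup_def)
  then show "\<phi> x (a + b) = \<phi> x a + \<phi> x b"
    using x by (auto simp: auto_def hom_def additive_group_def)
  have mult: "\<phi> (z \<otimes>\<^bsub>G\<^esub> y) = \<phi> z \<circ> \<phi> y" if "z \<in> carrier G" "y \<in> carrier G" for z y
  proof -
    have "\<phi> (z \<otimes>\<^bsub>G\<^esub> y) = \<phi> z \<otimes>\<^bsub>AutoGroup (additive_group TYPE('a))\<^esub> \<phi> y"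
      using hom that by (auto simp: hom_def)
    moreover have "\<phi> z \<in> Bij UNIV" "\<phi> y \<in> Bij UNIV"
      using auto that by (auto simp: auto_def additive_group_def)
    ultimately show ?thesis
      by (auto simp: AutoGroup_def BijGroup_def additive_group_def compose_def)
  qed
  then show "y \<in> carrier G \<Longrightarrow> \<phi> (x \<otimes>\<^bsub>G\<^esub> y) = \<phi> x \<circ> \<phi> y"
    using x by blast
  have "\<phi> \<one>\<^bsub>G\<^esub> \<in> Bij UNIV" using auto[of "\<one>\<^bsub>G\<^esub>"] by (auto simp: auto_def additive_group_def)
  then have "inj (\<phi> \<one>\<^bsub>G\<^esub>)" by (auto simp: Bij_def bij_betw_def)
  moreover have "\<phi> \<one>\<^bsub>G\<^esub> (\<phi> \<one>\<^bsub>G\<^esub> c) = \<phi> \<one>\<^bsub>G\<^esub> c" for c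
    using mult[of "\<one>\<^bsub>G\<^esub>" "\<one>\<^bsub>G\<^esub>"] by (simp add: fun_eq_iff)
  ultimately show "\<phi> \<one>\<^bsub>G\<^esub> = id" by (auto simp: fun_eq_iff dest: injD)
qed

lemma prime_order_subgroup:
  assumes "group G" "finite (carrier G)" "prime (order G)" "subgroup H G"
    and x: "x \<in> H" "x \<noteq> \<one>\<^bsub>G\<^esub>"
  shows "H = carrier G"
proof -
  interpret group G by fact
  have sub: "H \<subseteq> carrier G" using \<open>subgroup H G\<close> by (rule subgroup.subset)
  have fin: "finite H" using sub \<open>finite (carrier G)\<close> by (rule finite_subset)
  have "card H dvd order G"
    using lagrange[OF \<open>subgroup H G\<close>] by (metis dvd_triv_right)
  then have "card H = 1 \<or> card H = order G"
    using \<open>prime (order G)\<close> by (simp add: prime_nat_iff)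
  moreover have "card H \<noteq> 1"
  proof
    assume "card H = 1"
    then obtain z where "H = {z}" by (auto simp: card_1_singleton_iff)
    then show False using x subgroup.one_closed[OF \<open>subgroup H G\<close>] by auto
  qed
  ultimately show ?thesis
    using card_subset_eq[OF \<open>finite (carrier G)\<close> sub] by (simp add: order_def)
qed

lemma prime_order_pow:
  assumes "group G" "finite (carrier G)" "prime (order G)"
    and x: "x \<in> carrier G" "x \<noteq> \<one>\<^bsub>G\<^esub>"
  shows "x [^]\<^bsub>G\<^esub> order G = \<one>\<^bsub>G\<^esub>"
proof -
  interpret group G by fact
  have "subgroup (generate G {x}) G"
    by (rule generate_is_subgroup) (simp add: x)
  then have "generate G {x} = carrier G"
    using prime_order_subgroup[OF assms(1-3)] generate.incl[of x "{x}"] x(2) by blast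
  then have "carrier G = range (\<lambda>i::int. x [^]\<^bsub>G\<^esub> i)"
    unfolding generate_pow[OF x(1)] by auto
  then have "comm_group G"
    using x(1) cyclic_group cyclic_imp_abelian_group by blast
  then show ?thesis
    unfolding order_def by (rule comm_group.power_order_eq_one[OF _ assms(2) x(1)])
qed

theorem mainTheorem3:
  fixes G :: "('g, 'b) monoid_scheme"
    and \<phi> :: "'g \<Rightarrow> 'a::ab_group_add \<Rightarrow> 'a"
  assumes "free_abelian_finite_rank (additive_group TYPE('a))"
    and "group G" and "finite (carrier G)"
    and "\<phi> \<in> hom G (AutoGroup (additive_group TYPE('a)))"
    and "inj_on \<phi> (carrier G)"
    and "\<not> CHAR('k::field) dvd order G"
    and "prime (order G)" and "odd (order G)"
  shows "\<not> semigroup_algebra_on TYPE('m::comm_monoid_add)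
           (invariant_algebra G \<phi> :: ('a \<Rightarrow>\<^sub>0 'k) set)"
proof
  assume "semigroup_algebra_on TYPE('m) (invariant_algebra G \<phi> :: ('a \<Rightarrow>\<^sub>0 'k) set)"
  then obtain F :: "('m \<Rightarrow>\<^sub>0 'k) \<Rightarrow> ('a \<Rightarrow>\<^sub>0 'k)" where F: "algebra_iso_onto F (invariant_algebra G \<phi>)"
    unfolding semigroup_algebra_on_def by blast
  interpret group G by fact
  note action = AutoGroup_action[OF assms(2,4)]
  obtain \<iota> :: "'a \<Rightarrow> (nat \<Rightarrow>\<^sub>0 int)" and n
    where \<iota>: "\<And>a b. \<iota> (a + b) = \<iota> a + \<iota> b" "inj \<iota>" "range \<iota> = {x. Poly_Mapping.keys x \<subseteq> {..<n}}"
    using free_abelian_finite_rank_coordinates[OF assms(1)] by auto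
  have "card (carrier G) \<noteq> 1" using assms(7) by (auto simp: order_def)
  then have "carrier G \<noteq> {\<one>\<^bsub>G\<^esub>}" by auto
  \<comment> \<open>Any such \<open>x\<close> generates the group, whose order is prime;
    \<open>\<phi> x\<close> plays the role of g.\<close>
  then obtain x where x: "x \<in> carrier G" "x \<noteq> \<one>\<^bsub>G\<^esub>" using one_closed by blast
  have pow: "\<phi> (x [^]\<^bsub>G\<^esub> i) = (\<phi> x ^^ i)" for i :: nat
  proof (induction i)
    case 0
    then show ?case using action(3)[OF x(1)] by simp
  next
    case (Suc i)
    have "\<phi> (x [^]\<^bsub>G\<^esub> i \<otimes>\<^bsub>G\<^esub> x) = \<phi> (x [^]\<^bsub>G\<^esub> i) \<circ> \<phi> x"
      using action(2)[of "x [^]\<^bsub>G\<^esub> i" x] x(1) by simp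
    then show ?case by (simp only: Suc.IH nat_pow_Suc funpow_Suc_right)
  qed
  interpret lattice_invariants \<iota> n "\<phi> x" "order G" "TYPE('k)"
  proof
    show "(\<phi> x ^^ order G) a = a" for a
      unfolding pow[symmetric] prime_order_pow[OF assms(2,3,7) x] using action(3)[OF x(1)] by simp
    \<comment> \<open>Faithfulness enters here: it makes \<open>\<phi> x\<close> move some
      vector.\<close>
    have "\<phi> x \<noteq> \<phi> \<one>\<^bsub>G\<^esub>" using assms(5) x one_closed by (metis inj_onD)
    then show "\<exists>a. \<phi> x a \<noteq> a" using action(3)[OF x(1)] by (auto simp: fun_eq_iff)
    show "of_nat (order G) \<noteq> (0::'k)" using assms(6) by (simp add: of_nat_eq_0_iff_char_dvd)
  qed (fact \<iota> assms action(1)[OF x(1)])+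
  have "invariant_algebra G \<phi> = Inv"
  proof
    show "invariant_algebra G \<phi> \<subseteq> Inv"
      using x(1) by (auto simp: invariant_algebra_def Inv_def)
    show "Inv \<subseteq> invariant_algebra G \<phi>"
    proof
      fix s assume s: "s \<in> Inv"
      \<comment> \<open>The stabilizer of \<open>s\<close> is a subgroup containing
        \<open>x\<close>, hence the whole group: invariance under the generator suffices.\<close>
      let ?H = "{y \<in> carrier G. linear_extension (\<phi> y) s = s}"
      have comp: "linear_extension (\<phi> (y \<otimes>\<^bsub>G\<^esub> z)) s = linear_extension (\<phi> y) (linear_extension (\<phi> z) s)"
        if "y \<in> carrier G" "z \<in> carrier G" for y z
        using action(2)[OF that] by (simp add: linear_extension_comp)
      have one: "linear_extension (\<phi> \<one>\<^bsub>G\<^esub>) s = s"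
        unfolding action(3)[OF x(1)] by (rule linear_extension_id)
      have "subgroup ?H G"
      proof (rule subgroupI)
        show "?H \<noteq> {}" using one one_closed by blast
        show "?H \<subseteq> carrier G" by blast
        fix y assume "y \<in> ?H"
        then have y: "y \<in> carrier G" "linear_extension (\<phi> y) s = s" by blast+
        have "linear_extension (\<phi> (inv\<^bsub>G\<^esub> y)) s = s"
          using comp[OF inv_closed[OF y(1)] y(1)] unfolding l_inv[OF y(1)] y(2) one by (rule sym)
        then show "inv\<^bsub>G\<^esub> y \<in> ?H" using y(1) by simp
        fix z assume "z \<in> ?H"
        then have z: "z \<in> carrier G" "linear_extension (\<phi> z) s = s" by blast+
        show "y \<otimes>\<^bsub>G\<^esub> z \<in> ?H"
          using comp[OF y(1) z(1)] unfolding z(2) y(2) using y(1) z(1) by blast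
      qed
      moreover have "x \<in> ?H" using s x(1) by (simp add: Inv_def)
      ultimately have "?H = carrier G"
        using prime_order_subgroup[OF assms(2,3,7)] x(2) by blast
      then show "s \<in> invariant_algebra G \<phi>"
        by (auto simp: invariant_algebra_def)
    qed
  qed
  then show False using no_monoid_basis F by metis
qed

end
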